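(* Let $\mathbb{X}\subset\mathbb{R}^{d}$ be a closed subset with reach $\tau>0$, let $\mathcal{X}\subset\mathbb{R}^{d}$ be a set of points, and let $r=\{r_x>0: x\in\mathcal{X}\}$ be a set of radii indexed by $x\in\mathcal{X}$, with $\mathbb{B}_{\mathbb{X}}(x,r_x)\neq\emptyset$ for all $x\in\mathcal{X}$. Suppose $r_x\le\sqrt{\tau^{2}+(\tau-d_{\mathbb{X}}(x))^{2}}$ for all $x\in\mathcal{X}$. Then the union of restricted balls $\bigcup_{x\in\mathcal{X}}\mathbb{B}_{\mathbb{X}}(x,r_x)$ is homotopy equivalent to the restricted Čech complex $\mathrm{\check{C}ech}_{\mathbb{X}}(\mathcal{X},r)$. If, in addition, the union of restricted balls covers $\mathbb{X}$, that is, $\mathbb{X}\subset\bigcup_{x\in\mathcal{X}}\mathbb{B}_{\mathbb{X}}(x,r_x)$, then $\mathbb{X}$ is homotopy equivalent to $\mathrm{\check{C}ech}_{\mathbb{X}}(\mathcal{X},r)$.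
   Context: $\|\cdot\|$ is the Euclidean norm and $d_{\mathbb{X}}(x)=\inf_{y\in\mathbb{X}}\|x-y\|$. For $x\in\mathbb{R}^d$ and $r>0$, $\mathbb{B}_{\mathbb{X}}(x,r)=\{y\in\mathbb{X}:\|x-y\|<r\}$. For a closed set $\mathbb{X}$, $\mathrm{Med}(\mathbb{X})=\{x\in\mathbb{R}^d\setminus\mathbb{X}: \exists\, q_1\ne q_2\in\mathbb{X},\ \|q_1-x\|=\|q_2-x\|=d_{\mathbb{X}}(x)\}$, and the reach is $\tau_{\mathbb{X}}=\inf\{\|q-x\|: q\in\mathbb{X},\ x\in\mathrm{Med}(\mathbb{X})\}$, which is $\infty$ exactly when $\mathbb{X}$ is convex (the bound on $r_x$ is then vacuous). The restricted (weighted) Čech complex $\mathrm{\check{C}ech}_{\mathbb{X}}(\mathcal{X},r)$ is the abstract simplicial complex whose simplices are the finite sets $\sigma=\{x_1,\dots,x_k\}\subset\mathcal{X}$ with $\bigcap_{j=1}^{k}\mathbb{B}_{\mathbb{X}}(x_j,r_{x_j})\neq\emptyset$. Homotopy statements about a simplicial complex refer to its geometric realization. *)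

theory Defs
  imports "HOL-Analysis.Analysis"
begin

definition restricted_ball :: "'a::real_normed_vector set \<Rightarrow> 'a \<Rightarrow> real \<Rightarrow> 'a set" where
  "restricted_ball X x r = {y \<in> X. norm (x - y) < r}"

definition medial_axis :: "'a::real_normed_vector set \<Rightarrow> 'a set" where
  "medial_axis X = {x. x \<notin> X \<and>
     (\<exists>q1\<in>X. \<exists>q2\<in>X. q1 \<noteq> q2 \<and> norm (q1 - x) = infdist x X \<and> norm (q2 - x) = infdist x X)}"

text \<open>The value is extended: an empty medial axis gives reach \<open>\<infinity>\<close>.\<close>

definition reach :: "'a::real_normed_vector set \<Rightarrow> ereal" where
  "reach X = Inf {ereal (norm (q - x)) | q x. q \<in> X \<and> x \<in> medial_axis X}"

definition abstract_simplicial_complex :: "'v set set \<Rightarrow> bool" where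
  "abstract_simplicial_complex K \<longleftrightarrow>
     (\<forall>\<sigma>\<in>K. finite \<sigma> \<and> \<sigma> \<noteq> {} \<and> (\<forall>\<rho>. \<rho> \<subseteq> \<sigma> \<and> \<rho> \<noteq> {} \<longrightarrow> \<rho> \<in> K))"

definition cech_complex ::
    "'a::real_normed_vector set \<Rightarrow> 'a set \<Rightarrow> ('a \<Rightarrow> real) \<Rightarrow> 'a set set" where
  "cech_complex X P r =
     {\<sigma>. finite \<sigma> \<and> \<sigma> \<noteq> {} \<and> \<sigma> \<subseteq> P \<and> (\<Inter>x\<in>\<sigma>. restricted_ball X x (r x)) \<noteq> {}}"

lemma abstract_simplicial_complex_cech: "abstract_simplicial_complex (cech_complex X P r)"
  unfolding abstract_simplicial_complex_def cech_complex_def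
  by (auto intro: finite_subset) blast

text \<open>Points of the realization are given by their barycentric coordinates. The topology is
  the weak (coherent) one: \<open>U\<close> is open iff its trace on every closed simplex is open. On a
  single (finite) simplex the product topology is the Euclidean one.\<close>

definition simplex_realization :: "'v set \<Rightarrow> ('v \<Rightarrow> real) set" where
  "simplex_realization \<sigma> = {t. (\<forall>v. 0 \<le> t v) \<and> (\<forall>v. v \<notin> \<sigma> \<longrightarrow> t v = 0) \<and> sum t \<sigma> = 1}"

definition geometric_realization :: "'v set set \<Rightarrow> ('v \<Rightarrow> real) topology" where
  "geometric_realization K = topology (\<lambda>U. U \<subseteq> (\<Union>\<sigma>\<in>K. simplex_realization \<sigma>) \<and>
     (\<forall>\<sigma>\<in>K. openin (subtopology (powertop_real UNIV) (simplex_realization \<sigma>))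
                   (U \<inter> simplex_realization \<sigma>)))"

lemma openin_geometric_realization:
  "openin (geometric_realization K) U \<longleftrightarrow> U \<subseteq> (\<Union>\<sigma>\<in>K. simplex_realization \<sigma>) \<and>
     (\<forall>\<sigma>\<in>K. openin (subtopology (powertop_real UNIV) (simplex_realization \<sigma>))
                   (U \<inter> simplex_realization \<sigma>))"
proof -
  let ?L = "\<lambda>U. U \<subseteq> (\<Union>\<sigma>\<in>K. simplex_realization \<sigma>) \<and>
     (\<forall>\<sigma>\<in>K. openin (subtopology (powertop_real UNIV) (simplex_realization \<sigma>))
                   (U \<inter> simplex_realization \<sigma>))"
  have "?L (S \<inter> T)" if S: "?L S" and T: "?L T" for S T
  proof -
    have "(S \<inter> T) \<inter> A = (S \<inter> A) \<inter> (T \<inter> A)" for A by blast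
    then show ?thesis using S T by (auto intro: openin_Int)
  qed
  moreover have "?L (\<Union>\<U>)" if \<U>: "\<forall>U\<in>\<U>. ?L U" for \<U>
  proof -
    have "\<Union>\<U> \<inter> A = (\<Union>U\<in>\<U>. U \<inter> A)" for A by blast
    moreover have "openin (subtopology (powertop_real UNIV) (simplex_realization \<sigma>))
        (\<Union>U\<in>\<U>. U \<inter> simplex_realization \<sigma>)" if "\<sigma> \<in> K" for \<sigma>
      using \<U> that by (intro openin_Union) auto
    ultimately show ?thesis using \<U> by auto
  qed
  ultimately have "istopology ?L"
    unfolding istopology_def by blast
  then show ?thesis
    unfolding geometric_realization_def by (simp add: topology_inverse')
qed

lemma topspace_geometric_realization:
  "topspace (geometric_realization K) = (\<Union>\<sigma>\<in>K. simplex_realization \<sigma>)"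
proof -
  have "openin (geometric_realization K) (\<Union>\<sigma>\<in>K. simplex_realization \<sigma>)"
    unfolding openin_geometric_realization
  proof (intro conjI ballI subset_refl)
    fix \<sigma> assume "\<sigma> \<in> K"
    then have "(\<Union>\<sigma>\<in>K. simplex_realization \<sigma>) \<inter> simplex_realization \<sigma> = simplex_realization \<sigma>"
      by blast
    then show "openin (subtopology (powertop_real UNIV) (simplex_realization \<sigma>))
        ((\<Union>\<sigma>\<in>K. simplex_realization \<sigma>) \<inter> simplex_realization \<sigma>)"
      by (simp add: openin_subtopology_refl)
  qed
  then show ?thesis
    using openin_geometric_realization[of K "topspace (geometric_realization K)"]
    by (meson openin_subset openin_topspace subset_antisym)
qed

end

theory Submission
  imports Defs
begin

text \<open>
  Let \<open>\<pi>\<close> be the nearest-point projection, defined and continuous on the points at distance less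
  than the reach from \<open>X\<close>. For every radius \<open>\<tau>\<close> up to the reach, each \<open>z \<notin> X\<close> in that neighbourhood
  lies on the radius from \<open>\<pi> z\<close> to the centre of a ball of radius \<open>\<tau>\<close> touching \<open>X\<close> at \<open>\<pi> z\<close> and
  disjoint from \<open>X\<close> in its interior. Comparing squared distances to such centres shows that, under
  the radius bound, \<open>\<pi>\<close> is defined on the convex hull of a restricted ball and maps it back into
  that ball.

  This gives explicit homotopy inverses for the nerve. One map \<open>f\<close> is a locally finite partition
  of unity. In the other direction, pick a point \<open>y \<sigma>\<close> in the common part of the balls of each
  simplex \<open>\<sigma>\<close>, and let \<open>g t\<close> be the projection of a weighted mean of the \<open>y \<sigma>\<close>, where only those
  \<open>\<sigma>\<close> have weight that contain every vertex whose coordinate in \<open>t\<close> exceeds a positive threshold.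
  Then \<open>g t\<close> lies in the ball of each such vertex. So the projected segment from \<open>z\<close> to \<open>g (f z)\<close>
  stays in one ball, and \<open>f (g t)\<close> shares a simplex with the truncation of \<open>t\<close> at the threshold,
  which in turn shares a simplex with \<open>t\<close>.
\<close>

subsection \<open>Projection onto a set of positive reach\<close>

lemma closest_point_infdist:
  fixes X :: "'a::euclidean_space set"
  assumes "closed X" "X \<noteq> {}"
  shows "closest_point X z \<in> X" "dist z (closest_point X z) = infdist z X"
proof -
  show in_X: "closest_point X z \<in> X"
    using closest_point_exists[OF assms] by auto
  have "dist z (closest_point X z) \<le> infdist z X"
    unfolding infdist_notempty[OF assms(2)]
    by (intro cINF_greatest) (use assms closest_point_le in auto)
  then show "dist z (closest_point X z) = infdist z X"
    using infdist_le[OF in_X] by (simp add: order_antisym)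
qed

text \<open>A second nearest point would make \<open>z\<close> a point of the medial axis at
  distance \<open>infdist z X\<close> from \<open>q\<close>, so the reach could not exceed that
  distance.\<close>

lemma closest_point_eqI:
  fixes X :: "'a::euclidean_space set"
  assumes "closed X" "ereal (infdist z X) < reach X" "q \<in> X" "dist z q \<le> infdist z X"
  shows "closest_point X z = q"
proof (rule ccontr)
  assume ne: "closest_point X z \<noteq> q"
  define p where "p = closest_point X z"
  have X: "X \<noteq> {}" using assms by auto
  have p: "p \<in> X" "dist z p = infdist z X"
    using closest_point_infdist[OF assms(1) X] by (auto simp: p_def)
  have q: "dist z q = infdist z X"
    using assms infdist_le by (metis order_antisym)
  have "z \<notin> X"
    using p q ne unfolding p_def by auto
  moreover have "norm (p - z) = infdist z X" "norm (q - z) = infdist z X"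
    using p q by (metis dist_norm dist_commute)+
  ultimately have "z \<in> medial_axis X"
    unfolding medial_axis_def using p(1) ne assms(3) by (auto simp: p_def)
  then have "reach X \<le> ereal (norm (q - z))"
    unfolding reach_def using assms(3) by (intro Inf_lower) auto
  with q assms(2) show False
    by (simp add: dist_norm norm_minus_commute)
qed

lemma open_infdist_less_reach:
  fixes X :: "'a::euclidean_space set"
  shows "open {z. ereal (infdist z X) < reach X}"
  by (intro open_Collect_less continuous_on_ereal continuous_intros)

text \<open>By uniqueness of the nearest point, the graph of the projection is cut out by closed
  conditions. Locally the values stay in a compact ball, and a map into a compact space with closed
  graph is continuous.\<close>

lemma continuous_on_closest_point_reach:
  fixes X :: "'a::euclidean_space set"
  assumes X: "closed X"
  shows "continuous_on {z. ereal (infdist z X) < reach X} (closest_point X)"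
proof (cases "X = {}")
  case True
  then show ?thesis by (simp add: closest_point_def)
next
  case False
  note assms = X False
  let ?T = "{z. ereal (infdist z X) < reach X}"
  have "isCont (closest_point X) z" if z: "z \<in> ?T" for z
  proof -
    let ?S = "?T \<inter> ball z 1"
    \<comment> \<open>One unit of the 2 is for moving from \<open>z\<close> to \<open>y\<close>, the
      other for \<open>infdist y X\<close> exceeding \<open>infdist z X\<close>.\<close>
    let ?C = "cball z (infdist z X + 2)"
    have maps: "closest_point X \<in> ?S \<rightarrow> ?C"
    proof
      fix y assume y: "y \<in> ?S"
      have "dist z (closest_point X y) \<le> dist z y + dist y (closest_point X y)"
        by (rule dist_triangle)
      also have "dist y (closest_point X y) = infdist y X"
        using closest_point_infdist[OF assms] by simp
      also have "infdist y X \<le> infdist z X + dist y z"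
        by (rule infdist_triangle)
      finally show "closest_point X y \<in> ?C"
        using y by (simp add: dist_commute)
    qed
    have graph: "(\<lambda>x. (x, closest_point X x)) ` ?S =
        (?S \<times> ?C) \<inter> {w. snd w \<in> X \<and> dist (fst w) (snd w) = infdist (fst w) X}" (is "?L = ?R")
    proof
      show "?L \<subseteq> ?R"
        using closest_point_infdist[OF assms] maps by auto
      show "?R \<subseteq> ?L"
      proof
        fix w assume w: "w \<in> ?R"
        then have "closest_point X (fst w) = snd w"
          by (intro closest_point_eqI[OF assms(1)]) auto
        with w show "w \<in> ?L" by (auto simp: image_iff prod_eq_iff)
      qed
    qed
    have "closed {w::'a \<times> 'a. snd w \<in> X \<and> dist (fst w) (snd w) = infdist (fst w) X}"
    proof (intro closed_Collect_conj)
      show "closed {w::'a \<times> 'a. snd w \<in> X}"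
        using closed_vimage_snd[OF assms(1)] by (simp add: vimage_def)
      show "closed {w::'a \<times> 'a. dist (fst w) (snd w) = infdist (fst w) X}"
        by (intro closed_Collect_eq continuous_intros)
    qed
    then have "continuous_on ?S (closest_point X)"
      unfolding continuous_closed_graph_eq[OF compact_cball maps] graph
      by (meson closedin_closed_Int)
    moreover have "open ?S" "z \<in> ?S"
      using open_infdist_less_reach[of X] z by auto
    ultimately show ?thesis
      by (simp add: continuous_on_eq_continuous_at)
  qed
  then show ?thesis
    by (simp add: continuous_at_imp_continuous_on)
qed

section \<open>Normal rays and balls tangent to the set\<close>

text \<open>The distance to \<open>X\<close> is 1-Lipschitz, so between \<open>s'\<close> and
  \<open>s\<close> it grows by at most \<open>s - s'\<close>. A deficit at \<open>s'\<close> would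
  persist up to \<open>s\<close>.\<close>

lemma infdist_ray:
  fixes X :: "'a::euclidean_space set"
  assumes "q \<in> X" "norm u = 1" "infdist (q + s *\<^sub>R u) X = s" "0 \<le> s'" "s' \<le> s"
  shows "infdist (q + s' *\<^sub>R u) X = s'"
proof (rule antisym)
  show "infdist (q + s' *\<^sub>R u) X \<le> s'"
    using infdist_le[OF assms(1), of "q + s' *\<^sub>R u"] assms by (simp add: dist_norm)
  have "infdist (q + s *\<^sub>R u) X \<le> infdist (q + s' *\<^sub>R u) X + dist (q + s *\<^sub>R u) (q + s' *\<^sub>R u)"
    by (rule infdist_triangle)
  also have "dist (q + s *\<^sub>R u) (q + s' *\<^sub>R u) = s - s'"
    using assms by (simp add: dist_norm flip: scaleR_diff_left)
  finally show "s' \<le> infdist (q + s' *\<^sub>R u) X"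
    using assms by simp
qed

text \<open>Federer's argument: a Brouwer fixed point of the map sending \<open>x\<close> to the point opposite
  \<open>closest_point X x\<close> on a small sphere about \<open>q + s *\<^sub>R u\<close> must lie on the ray itself.\<close>

lemma infdist_ray_extend:
  fixes X :: "'a::euclidean_space set"
  assumes "closed X" "q \<in> X" "norm u = 1" "infdist (q + s *\<^sub>R u) X = s" "0 < s" "ereal s < reach X"
  obtains \<epsilon> where "0 < \<epsilon>" "infdist (q + (s + \<epsilon>) *\<^sub>R u) X = s + \<epsilon>"
proof -
  let ?T = "{z. ereal (infdist z X) < reach X}"
  define x0 where "x0 = q + s *\<^sub>R u"
  have X: "X \<noteq> {}" using assms by auto
  have x0T: "x0 \<in> ?T" and d0: "infdist x0 X = s"
    using assms by (auto simp: x0_def)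
  have pi0: "closest_point X x0 = q"
    using assms by (intro closest_point_eqI) (auto simp: x0_def dist_norm)
  have cont: "continuous_on ?T (closest_point X)"
    by (rule continuous_on_closest_point_reach[OF assms(1)])
  \<comment> \<open>Since \<open>x0\<close> has distance exactly \<open>s\<close> from
    \<open>q\<close>, foot points in the open ball about \<open>q\<close> differ from
    \<open>x0\<close>. This makes the division in \<open>f\<close> legitimate.\<close>
  have "open (?T \<inter> closest_point X -` ball q s)"
    by (intro continuous_open_preimage[OF cont open_infdist_less_reach]) auto
  moreover have "x0 \<in> ?T \<inter> closest_point X -` ball q s"
    using x0T pi0 assms by auto
  ultimately obtain \<epsilon> where \<epsilon>: "0 < \<epsilon>" "cball x0 \<epsilon> \<subseteq> ?T \<inter> closest_point X -` ball q s"
    by (metis open_contains_cball)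
  have ne: "x0 \<noteq> closest_point X x" if "x \<in> cball x0 \<epsilon>" for x
  proof
    assume "x0 = closest_point X x"
    then have "dist q x0 < s" using \<epsilon> that by auto
    then show False using assms by (simp add: x0_def dist_norm)
  qed
  define f where "f x = x0 + (\<epsilon> / norm (x0 - closest_point X x)) *\<^sub>R (x0 - closest_point X x)" for x
  have "continuous_on (cball x0 \<epsilon>) f"
    unfolding f_def
    by (intro continuous_intros continuous_on_subset[OF cont]) (use \<epsilon> ne in \<open>auto dest: ne\<close>)
  moreover have "f \<in> cball x0 \<epsilon> \<rightarrow> cball x0 \<epsilon>"
    using \<epsilon> ne by (auto simp: f_def dist_norm)
  ultimately obtain x where x: "x \<in> cball x0 \<epsilon>" "f x = x"
    using brouwer[of "cball x0 \<epsilon>" f] \<epsilon> by (auto simp: less_imp_le)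
  define p where "p = closest_point X x"
  define l where "l = norm (x0 - p)"
  have l: "0 < l" using ne[OF x(1)] by (auto simp: l_def p_def)
  have p: "p \<in> X" "dist x p = infdist x X"
    using closest_point_infdist[OF assms(1) X] by (auto simp: p_def)
  have xeq: "x = x0 + (\<epsilon> / l) *\<^sub>R (x0 - p)"
    using x(2) by (simp add: f_def p_def l_def)
  have "x - p = (1 + \<epsilon> / l) *\<^sub>R (x0 - p)"
    unfolding xeq by (simp add: algebra_simps)
  then have "norm (x - p) = (1 + \<epsilon> / l) * l"
    using l \<epsilon> by (simp add: l_def)
  also have "\<dots> = l + \<epsilon>"
    using l by (simp add: distrib_right)
  finally have dx: "infdist x X = l + \<epsilon>"
    using p by (simp add: dist_norm)
  \<comment> \<open>At the fixed point, \<open>x0\<close> lies between \<open>p\<close> and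
    \<open>x\<close>. The Lipschitz bound for the distance to \<open>X\<close> therefore makes
    \<open>p\<close> a nearest point of \<open>x0\<close> as well, and uniqueness gives
    \<open>p = q\<close>.\<close>
  have "dist x x0 = \<epsilon>"
    unfolding xeq using l \<epsilon> by (simp add: dist_norm l_def)
  then have "dist x0 p \<le> infdist x0 X"
    using infdist_triangle[of x X x0] dx by (simp add: dist_norm l_def)
  then have pq: "p = q"
    using closest_point_eqI[OF assms(1) _ p(1), of x0] x0T pi0 by auto
  then have ls: "l = s"
    using assms by (simp add: l_def x0_def)
  have "x = q + (s + \<epsilon>) *\<^sub>R u"
    unfolding xeq pq ls using assms by (simp add: x0_def algebra_simps)
  with dx ls that[OF \<epsilon>(1)] show ?thesis by simp
qed

text \<open>A continuation argument: if \<open>\<tau>\<close> were missed, the parameters at which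
  \<open>q\<close> is still nearest would form a closed bounded set, whose supremum lies below the
  reach and can be passed by \<open>infdist_ray_extend\<close>.\<close>

lemma infdist_ray_reach:
  fixes X :: "'a::euclidean_space set"
  assumes "closed X" "q \<in> X" "norm u = 1" "infdist (q + s *\<^sub>R u) X = s" "0 < s"
    and "0 \<le> \<tau>" "ereal \<tau> \<le> reach X"
  shows "infdist (q + \<tau> *\<^sub>R u) X = \<tau>"
proof (rule ccontr)
  assume ne: "infdist (q + \<tau> *\<^sub>R u) X \<noteq> \<tau>"
  define S where "S = {t. infdist (q + t *\<^sub>R u) X = t}"
  \<comment> \<open>By \<open>infdist_ray\<close>, a member of \<open>S\<close> at or above
    \<open>\<tau>\<close> would bring \<open>\<tau>\<close> itself into \<open>S\<close>.\<close>
  have less: "t < \<tau>" if "t \<in> S" for t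
    using that infdist_ray[OF assms(2,3), of t \<tau>] assms(6) ne unfolding S_def by force
  have bdd: "bdd_above S" using less by (meson bdd_aboveI less_imp_le)
  have sS: "s \<in> S" using assms by (simp add: S_def)
  have "closed S"
    unfolding S_def by (intro closed_Collect_eq continuous_intros)
  then have Sup: "Sup S \<in> S"
    using closed_contains_Sup[OF _ bdd] sS by auto
  have "s \<le> Sup S" by (rule cSup_upper[OF sS bdd])
  moreover have "ereal (Sup S) < reach X"
    using less[OF Sup] assms(7) by (metis ereal_less_eq(3) less_ereal.simps(1) order_less_le_trans)
  ultimately obtain \<epsilon> where \<epsilon>: "0 < \<epsilon>" "infdist (q + (Sup S + \<epsilon>) *\<^sub>R u) X = Sup S + \<epsilon>"
    using infdist_ray_extend[OF assms(1,2,3), of "Sup S"] Sup assms(5) by (auto simp: S_def)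
  then have "Sup S + \<epsilon> \<le> Sup S"
    by (intro cSup_upper[OF _ bdd]) (simp add: S_def)
  with \<epsilon> show False by simp
qed

text \<open>The centre \<open>c\<close> is the point at parameter \<open>\<tau>\<close> on the ray
  from \<open>q\<close> through \<open>z\<close>. The last equation gives the position of
  \<open>z\<close> on that ray in the form needed for
  \<open>dist_power2_affine_combination\<close>.\<close>

lemma reach_ball_tangent:
  fixes X :: "'a::euclidean_space set"
  assumes "closed X" "z \<notin> X" "X \<noteq> {}" "0 < \<tau>" "ereal \<tau> \<le> reach X"
  defines "q \<equiv> closest_point X z"
  obtains c where "\<And>y. y \<in> X \<Longrightarrow> \<tau> \<le> dist y c" "norm (c - q) = \<tau>"
    "z - q = (infdist z X / \<tau>) *\<^sub>R (c - q)"
proof -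
  define s where "s = infdist z X"
  have q: "q \<in> X" "dist z q = s"
    using closest_point_infdist[OF assms(1,3)] by (auto simp: q_def s_def)
  have s: "0 < s" using q assms(2) by (metis dist_pos_lt)
  define u where "u = (1/s) *\<^sub>R (z - q)"
  have u: "norm u = 1" using q s by (simp add: u_def dist_norm)
  have "q + s *\<^sub>R u = z" using s by (simp add: u_def)
  then have "infdist (q + \<tau> *\<^sub>R u) X = \<tau>"
    using infdist_ray_reach[OF assms(1) q(1) u, of s \<tau>] s assms by (simp add: s_def)
  then have "\<tau> \<le> dist y (q + \<tau> *\<^sub>R u)" if "y \<in> X" for y
    using infdist_le[OF that] by (metis dist_commute)
  then show ?thesis
    using assms(4) u s by (intro that[of "q + \<tau> *\<^sub>R u"]) (auto simp: s_def[symmetric] u_def)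
qed

subsection \<open>Restricted balls\<close>

text \<open>Stewart's theorem for the point \<open>x\<close> on the line through \<open>p\<close>
  and \<open>c\<close>.\<close>

lemma dist_power2_affine_combination:
  fixes y :: "'a::real_inner"
  assumes "x - p = a *\<^sub>R (c - p)"
  shows "(dist y x)\<^sup>2 = (1 - a) * (dist y p)\<^sup>2 + a * (dist y c)\<^sup>2 - a * (1 - a) * (norm (c - p))\<^sup>2"
proof -
  define v w where "v = y - p" and "w = c - p"
  have eqs: "y - x = v - a *\<^sub>R w" "y - c = v - w"
    using assms by (simp_all add: v_def w_def algebra_simps)
  show ?thesis
    unfolding dist_norm eqs v_def[symmetric] w_def[symmetric] power2_norm_eq_inner
    by (simp add: inner_diff_left inner_diff_right inner_commute algebra_simps)
qed

text \<open>The quadratic terms cancel, so the inequality describes an open half-space.\<close>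

lemma convex_hull_dist_power2_diff:
  fixes z :: "'a::real_inner"
  assumes "z \<in> convex hull A" "\<And>y. y \<in> A \<Longrightarrow> (dist y a)\<^sup>2 - (dist y b)\<^sup>2 < k"
  shows "(dist z a)\<^sup>2 - (dist z b)\<^sup>2 < k"
proof -
  have eq: "(dist y a)\<^sup>2 - (dist y b)\<^sup>2 < k \<longleftrightarrow> inner (2 *\<^sub>R (b - a)) y < k - inner a a + inner b b" for y
    unfolding dist_norm power2_norm_eq_inner
    by (simp add: inner_diff_left inner_diff_right inner_commute algebra_simps)
  have "convex hull A \<subseteq> {y. inner (2 *\<^sub>R (b - a)) y < k - inner a a + inner b b}"
    using assms(2) eq by (intro hull_minimal convex_halfspace_lt) auto
  with assms(1) eq show ?thesis by auto
qed

text \<open>For the second bound, Stewart's identity is applied to the foot point \<open>p\<close>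
  of \<open>x\<close> and the centre \<open>c\<close> of the tangent ball at \<open>p\<close>, from
  which \<open>y\<close> has distance at least \<open>\<tau>\<close>. As
  \<open>\<tau> - d = (1 - a) * \<tau>\<close>, the radius bound makes all terms add up to
  \<open>(1 - a) * (2 * \<tau>\<^sup>2)\<close>.\<close>

lemma restricted_ball_dist_closest_point:
  fixes X :: "'a::euclidean_space set"
  assumes X: "closed X" and \<tau>: "0 < \<tau>" "ereal \<tau> \<le> reach X"
    and r: "0 < r" "r \<le> sqrt (\<tau>\<^sup>2 + (\<tau> - infdist x X)\<^sup>2)"
    and y: "y \<in> restricted_ball X x r"
  shows "infdist x X < \<tau>" "(dist y (closest_point X x))\<^sup>2 < 2 * \<tau>\<^sup>2"
proof -
  define d p where "d = infdist x X" and "p = closest_point X x"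
  have yX: "y \<in> X" and yx: "dist y x < r"
    using y by (auto simp: restricted_ball_def dist_norm norm_minus_commute)
  have ne: "X \<noteq> {}" using yX by auto
  have d: "0 \<le> d" "d < r"
    using infdist_le[OF yX, of x] yx infdist_nonneg[of x X] by (auto simp: d_def dist_commute)
  have r2: "r\<^sup>2 \<le> \<tau>\<^sup>2 + (\<tau> - d)\<^sup>2"
    using power_mono[OF r(2), of 2] r(1) by (simp add: d_def)
  \<comment> \<open>Combined with \<open>r2\<close>, the terms \<open>d\<^sup>2\<close> cancel and
    an inequality linear in \<open>d\<close> remains.\<close>
  have "d\<^sup>2 < r\<^sup>2" using d by (simp add: power_strict_mono)
  then have "2 * \<tau> * d < 2 * \<tau> * \<tau>"
    using r2 by (simp add: power2_eq_square algebra_simps)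
  then have d\<tau>: "d < \<tau>" using \<tau> by simp
  then show "infdist x X < \<tau>" by (simp add: d_def)
  have yx2: "(dist y x)\<^sup>2 < r\<^sup>2"
    using yx by (simp add: power_strict_mono)
  show "(dist y (closest_point X x))\<^sup>2 < 2 * \<tau>\<^sup>2"
  proof (cases "x \<in> X")
    case True
    then have "d = 0" "closest_point X x = x"
      using closest_point_self by (auto simp: d_def)
    with yx2 r2 show ?thesis by simp
  next
    case False
    obtain c where c: "\<And>y. y \<in> X \<Longrightarrow> \<tau> \<le> dist y c" "norm (c - p) = \<tau>"
        "x - p = (d / \<tau>) *\<^sub>R (c - p)"
      using reach_ball_tangent[OF X False ne \<tau>] unfolding p_def d_def by metis
    define a where "a = d / \<tau>"
    have a: "0 \<le> a" "a < 1" and da: "d = a * \<tau>"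
      using d d\<tau> \<tau> by (auto simp: a_def)
    have "(dist y x)\<^sup>2 = (1 - a) * (dist y p)\<^sup>2 + a * (dist y c)\<^sup>2 - a * (1 - a) * \<tau>\<^sup>2"
      using dist_power2_affine_combination[OF c(3), of y] c(2) by (simp add: a_def)
    moreover have "a * \<tau>\<^sup>2 \<le> a * (dist y c)\<^sup>2"
      using c(1)[OF yX] \<tau> a by (intro mult_left_mono power_mono) auto
    moreover have "(\<tau> - d)\<^sup>2 = (1 - a)\<^sup>2 * \<tau>\<^sup>2"
      unfolding da by (simp add: power2_eq_square algebra_simps)
    ultimately have "(1 - a) * (dist y p)\<^sup>2 < \<tau>\<^sup>2 + (1 - a)\<^sup>2 * \<tau>\<^sup>2 - a * \<tau>\<^sup>2 + a * (1 - a) * \<tau>\<^sup>2"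
      using yx2 r2 by linarith
    also have "\<dots> = (1 - a) * (2 * \<tau>\<^sup>2)"
      by (simp add: power2_eq_square algebra_simps)
    finally show ?thesis
      using a by (simp add: p_def)
  qed
qed

text \<open>If \<open>z\<close> is far from \<open>X\<close>, the squared distance to the foot point
  of \<open>x\<close> minus that to \<open>z\<close> is below
  \<open>2 * \<tau>\<^sup>2 - \<tau>\<^sup>2\<close> on the ball, hence on its hull. At
  \<open>z\<close> itself this puts the foot point closer than \<open>\<tau>\<close>, a
  contradiction.\<close>

lemma convex_hull_restricted_ball_infdist:
  fixes X :: "'a::euclidean_space set"
  assumes X: "closed X" and \<tau>: "0 < \<tau>" "ereal \<tau> \<le> reach X"
    and r: "0 < r" "r \<le> sqrt (\<tau>\<^sup>2 + (\<tau> - infdist x X)\<^sup>2)"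
    and z: "z \<in> convex hull (restricted_ball X x r)"
  shows "infdist z X < \<tau>"
proof (rule ccontr)
  assume far: "\<not> infdist z X < \<tau>"
  then have far: "\<tau> \<le> dist z y" if "y \<in> X" for y
    using infdist_le[OF that, of z] by simp
  have "restricted_ball X x r \<noteq> {}" using z by auto
  then have "X \<noteq> {}" by (auto simp: restricted_ball_def)
  then have p: "closest_point X x \<in> X"
    using closest_point_infdist[OF X] by blast
  have "(dist z (closest_point X x))\<^sup>2 - (dist z z)\<^sup>2 < \<tau>\<^sup>2"
  proof (rule convex_hull_dist_power2_diff[OF z])
    fix y assume y: "y \<in> restricted_ball X x r"
    then have "\<tau>\<^sup>2 \<le> (dist y z)\<^sup>2"
      using far[of y] \<tau> by (intro power_mono) (auto simp: restricted_ball_def dist_commute)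
    with restricted_ball_dist_closest_point(2)[OF X \<tau> r y]
    show "(dist y (closest_point X x))\<^sup>2 - (dist y z)\<^sup>2 < \<tau>\<^sup>2" by simp
  qed
  then have "dist z (closest_point X x) < \<tau>"
    using \<tau> by (simp add: power2_less_imp_less)
  with far[OF p] show False by simp
qed

text \<open>Let \<open>c\<close> be the centre of the tangent ball at the foot point
  \<open>q\<close> of \<open>z\<close>. Since \<open>z\<close> lies between \<open>q\<close> and
  \<open>c\<close>, a point \<open>q\<close> too far from \<open>x\<close> forces \<open>c\<close>
  to be closer to \<open>x\<close> than \<open>\<tau> - infdist x X\<close>. The foot point of
  \<open>x\<close> would then lie inside the tangent ball, whose interior misses
  \<open>X\<close>.\<close>

lemma closest_point_convex_hull_restricted_ball:
  fixes X :: "'a::euclidean_space set"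
  assumes X: "closed X" and \<tau>: "0 < \<tau>" "ereal \<tau> \<le> reach X"
    and r: "0 < r" "r \<le> sqrt (\<tau>\<^sup>2 + (\<tau> - infdist x X)\<^sup>2)"
    and z: "z \<in> convex hull (restricted_ball X x r)"
  shows "closest_point X z \<in> restricted_ball X x r"
proof -
  let ?A = "restricted_ball X x r"
  obtain y0 where y0: "y0 \<in> ?A" using z by fastforce
  then have ne: "X \<noteq> {}" by (auto simp: restricted_ball_def)
  define q p where "q = closest_point X z" and "p = closest_point X x"
  have q: "q \<in> X" and p: "p \<in> X" and dp: "dist x p = infdist x X"
    using closest_point_infdist[OF X ne] by (auto simp: p_def q_def)
  have d: "infdist x X < \<tau>"
    using restricted_ball_dist_closest_point(1)[OF X \<tau> r y0] .
  have "dist x q < r"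
  proof (cases "z \<in> X")
    case True
    have "convex hull ?A \<subseteq> ball x r"
      by (intro hull_minimal) (auto simp: restricted_ball_def dist_norm)
    with z True show ?thesis by (auto simp: q_def closest_point_self)
  next
    case False
    define b where "b = infdist z X / \<tau>"
    obtain c where c: "\<And>y. y \<in> X \<Longrightarrow> \<tau> \<le> dist y c" "norm (c - q) = \<tau>" "z - q = b *\<^sub>R (c - q)"
      using reach_ball_tangent[OF X False ne \<tau>] unfolding q_def b_def by metis
    have "0 < infdist z X"
      using X False ne by (simp add: infdist_pos_not_in_closed)
    then have b: "0 < b" "b < 1"
      using \<tau> convex_hull_restricted_ball_infdist[OF X \<tau> r z] by (auto simp: b_def)
    \<comment> \<open>a difference of two squared distances is affine, so a bound on the ball passes to its hull\<close>
    have hz: "(dist z x)\<^sup>2 - (dist z c)\<^sup>2 < r\<^sup>2 - \<tau>\<^sup>2"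
    proof (rule convex_hull_dist_power2_diff[OF z])
      fix y assume y: "y \<in> ?A"
      then have "(dist y x)\<^sup>2 < r\<^sup>2"
        by (intro power_strict_mono) (auto simp: restricted_ball_def dist_norm norm_minus_commute)
      moreover have "\<tau>\<^sup>2 \<le> (dist y c)\<^sup>2"
        using y c(1)[of y] \<tau> by (intro power_mono) (auto simp: restricted_ball_def)
      ultimately show "(dist y x)\<^sup>2 - (dist y c)\<^sup>2 < r\<^sup>2 - \<tau>\<^sup>2" by simp
    qed
    have zx: "(dist z x)\<^sup>2 = (1 - b) * (dist x q)\<^sup>2 + b * (dist x c)\<^sup>2 - b * (1 - b) * \<tau>\<^sup>2"
      using dist_power2_affine_combination[OF c(3), of x] c(2) by (simp add: dist_commute)
    have zc: "(dist z c)\<^sup>2 = (1 - b) * \<tau>\<^sup>2 - b * (1 - b) * \<tau>\<^sup>2"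
      using dist_power2_affine_combination[OF c(3), of c] c(2) by (simp add: dist_norm norm_minus_commute)
    have key: "(1 - b) * (dist x q)\<^sup>2 + b * (dist x c)\<^sup>2 < r\<^sup>2 - b * \<tau>\<^sup>2"
      using hz unfolding zx zc by (simp add: algebra_simps)
    show ?thesis
    proof (rule ccontr)
      assume "\<not> dist x q < r"
      then have "(1 - b) * r\<^sup>2 \<le> (1 - b) * (dist x q)\<^sup>2"
        using b r(1) by (intro mult_left_mono power_mono) auto
      then have "b * (dist x c)\<^sup>2 < b * (r\<^sup>2 - \<tau>\<^sup>2)"
        using key by (simp add: algebra_simps)
      then have "(dist x c)\<^sup>2 < r\<^sup>2 - \<tau>\<^sup>2"
        using b by simp
      also have "\<dots> \<le> (\<tau> - infdist x X)\<^sup>2"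
        using power_mono[OF r(2), of 2] r(1) by simp
      finally have "dist x c < \<tau> - infdist x X"
        using d by (simp add: power2_less_imp_less)
      then have "dist p c < \<tau>"
        using dp dist_triangle[of p c x] by (simp add: dist_commute)
      with c(1)[OF p] show False by simp
    qed
  qed
  with q show ?thesis by (simp add: q_def restricted_ball_def dist_norm)
qed

subsection \<open>Maps into and out of geometric realizations\<close>

text \<open>The support is the carrier of \<open>t\<close>, the smallest face containing it.\<close>

lemma simplex_realization_support:
  assumes "t \<in> simplex_realization \<sigma>" "finite \<sigma>"
  shows "{v. t v \<noteq> 0} \<subseteq> \<sigma>" "{v. t v \<noteq> 0} \<noteq> {}" "t \<in> simplex_realization {v. t v \<noteq> 0}"
proof -
  show sub: "{v. t v \<noteq> 0} \<subseteq> \<sigma>"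
    using assms by (auto simp: simplex_realization_def)
  have "sum t {v. t v \<noteq> 0} = sum t \<sigma>"
    using sub assms(2) by (intro sum.mono_neutral_left) auto
  then have sum: "sum t {v. t v \<noteq> 0} = 1"
    using assms by (simp add: simplex_realization_def)
  then show "{v. t v \<noteq> 0} \<noteq> {}" by (metis sum.empty zero_neq_one)
  show "t \<in> simplex_realization {v. t v \<noteq> 0}"
    using assms sum by (auto simp: simplex_realization_def)
qed

lemma simplex_realization_mono:
  assumes "finite \<tau>" "\<sigma> \<subseteq> \<tau>"
  shows "simplex_realization \<sigma> \<subseteq> simplex_realization \<tau>"
proof
  fix t assume t: "t \<in> simplex_realization \<sigma>"
  then have "sum t \<sigma> = sum t \<tau>"
    using assms by (intro sum.mono_neutral_left) (auto simp: simplex_realization_def)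
  with t assms show "t \<in> simplex_realization \<tau>"
    by (auto simp: simplex_realization_def)
qed

lemma convex_simplex_realization:
  assumes "a \<in> simplex_realization \<sigma>" "b \<in> simplex_realization \<sigma>" "0 \<le> s" "s \<le> (1::real)"
  shows "(\<lambda>v. (1 - s) * a v + s * b v) \<in> simplex_realization \<sigma>"
  using assms by (auto simp: simplex_realization_def sum.distrib simp flip: sum_distrib_left)

lemma continuous_on_coordinate:
  "continuous_on S (\<lambda>x::'a \<Rightarrow> 'b::topological_space. x i)"
  by (rule continuous_on_subset[OF continuous_on_product_coordinates]) simp

lemma closed_simplex_realization: "closed (simplex_realization \<sigma>)"
  unfolding simplex_realization_def
  by (intro closed_Collect_conj closed_Collect_all closed_Collect_imp closed_Collect_le
      closed_Collect_eq open_Collect_const continuous_on_const continuous_on_sum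
      continuous_on_coordinate)

lemma subtopology_powertop_real: "subtopology (powertop_real UNIV) S = top_of_set S"
  by (simp add: euclidean_product_topology)

lemma geometric_realization_support:
  assumes "abstract_simplicial_complex K" "t \<in> topspace (geometric_realization K)"
  shows "{v. t v \<noteq> 0} \<in> K" "t \<in> simplex_realization {v. t v \<noteq> 0}"
proof -
  obtain \<sigma> where \<sigma>: "\<sigma> \<in> K" "t \<in> simplex_realization \<sigma>"
    using assms(2) by (auto simp: topspace_geometric_realization)
  then have "finite \<sigma>" using assms(1) by (auto simp: abstract_simplicial_complex_def)
  note * = simplex_realization_support[OF \<sigma>(2) this]
  show "t \<in> simplex_realization {v. t v \<noteq> 0}" by (rule *)
  show "{v. t v \<noteq> 0} \<in> K"
    using * \<sigma>(1) assms(1) unfolding abstract_simplicial_complex_def by blast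
qed

section \<open>Continuity and homotopies for the weak topology\<close>

text \<open>Continuity of the coordinates controls only the product topology. Having finitely many
  vertices in play near each point is the extra condition that yields continuity into the weak
  topology.\<close>

definition locally_finite_support ::
    "'a::topological_space set \<Rightarrow> ('a \<Rightarrow> 'v \<Rightarrow> real) \<Rightarrow> bool" where
  "locally_finite_support S \<phi> \<longleftrightarrow>
     (\<forall>z\<in>S. \<exists>N F. open N \<and> z \<in> N \<and> finite F \<and> (\<forall>z'\<in>S \<inter> N. \<forall>v. \<phi> z' v \<noteq> 0 \<longrightarrow> v \<in> F))"

lemma locally_finite_support_finite:
  assumes "finite F" "\<And>z v. z \<in> S \<Longrightarrow> \<phi> z v \<noteq> 0 \<Longrightarrow> v \<in> F"
  shows "locally_finite_support S \<phi>"
  unfolding locally_finite_support_def using assms by (blast intro: open_UNIV)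

lemma locally_finite_support_compose:
  assumes "locally_finite_support S \<phi>" "continuous_on R g" "g ` R \<subseteq> S"
  shows "locally_finite_support R (\<lambda>z. \<phi> (g z))"
  unfolding locally_finite_support_def
proof
  fix z assume z: "z \<in> R"
  then obtain N F where N: "open N" "g z \<in> N" "finite F"
      "\<And>z' v. z' \<in> S \<inter> N \<Longrightarrow> \<phi> z' v \<noteq> 0 \<Longrightarrow> v \<in> F"
    using assms(1,3) unfolding locally_finite_support_def by (metis image_subset_iff)
  have "openin (top_of_set R) (R \<inter> g -` N)"
    by (rule continuous_openin_preimage_gen[OF assms(2) N(1)])
  then obtain M where M: "open M" "R \<inter> g -` N = R \<inter> M"
    by (auto simp: openin_open)
  have "v \<in> F" if "z' \<in> R \<inter> M" "\<phi> (g z') v \<noteq> 0" for z' v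
    using N(4)[of "g z'" v] that M assms(3) by blast
  moreover have "z \<in> M" using M z N by blast
  ultimately show "\<exists>N F. open N \<and> z \<in> N \<and> finite F \<and> (\<forall>z'\<in>R \<inter> N. \<forall>v. \<phi> (g z') v \<noteq> 0 \<longrightarrow> v \<in> F)"
    using M(1) N(3) by blast
qed

text \<open>Near a point all values lie in the finitely many simplices on a finite vertex set. What
  these have outside \<open>U\<close> is a finite union of closed sets, so avoiding it is an open
  condition already in the product topology.\<close>

lemma continuous_map_into_geometric_realization:
  assumes K: "abstract_simplicial_complex K"
    and cont: "continuous_on S \<phi>" and lf: "locally_finite_support S \<phi>"
    and im: "\<And>z. z \<in> S \<Longrightarrow> \<phi> z \<in> topspace (geometric_realization K)"
  shows "continuous_map (top_of_set S) (geometric_realization K) \<phi>"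
  unfolding continuous_map_def
proof (intro conjI allI impI)
  show "\<phi> \<in> topspace (top_of_set S) \<rightarrow> topspace (geometric_realization K)"
    using im by auto
  fix U assume U: "openin (geometric_realization K) U"
  have clo: "closed (simplex_realization \<sigma> - U)" if "\<sigma> \<in> K" for \<sigma>
  proof -
    have "openin (top_of_set (simplex_realization \<sigma>)) (U \<inter> simplex_realization \<sigma>)"
      using U that unfolding openin_geometric_realization subtopology_powertop_real by blast
    then have "closedin (top_of_set (simplex_realization \<sigma>)) (simplex_realization \<sigma> - U \<inter> simplex_realization \<sigma>)"
      by (metis closedin_diff closedin_topspace topspace_euclidean_subtopology)
    then have "closed (simplex_realization \<sigma> - U \<inter> simplex_realization \<sigma>)"
      using closed_simplex_realization closedin_closed_trans by blast
    then show ?thesis by (simp add: Diff_Int_distrib2 Diff_Int)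
  qed
  show "openin (top_of_set S) {x \<in> topspace (top_of_set S). \<phi> x \<in> U}"
  proof (subst openin_subopen, clarsimp)
    fix z assume z: "z \<in> S" "\<phi> z \<in> U"
    obtain N F where N: "open N" "z \<in> N" "finite F"
        "\<And>z' v. z' \<in> S \<inter> N \<Longrightarrow> \<phi> z' v \<noteq> 0 \<Longrightarrow> v \<in> F"
      using lf z unfolding locally_finite_support_def by metis
    define C where "C = (\<Union>\<sigma>\<in>{\<sigma>\<in>K. \<sigma> \<subseteq> F}. simplex_realization \<sigma> - U)"
    have "finite {\<sigma>\<in>K. \<sigma> \<subseteq> F}"
      using N(3) by (auto intro: finite_subset[of _ "Pow F"])
    then have "closed C" unfolding C_def using clo by (intro closed_UN) auto
    then have "openin (top_of_set S) (S \<inter> \<phi> -` (- C))"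
      by (intro continuous_openin_preimage_gen[OF cont]) auto
    moreover have "openin (top_of_set S) (S \<inter> N)"
      using N(1) by blast
    ultimately have "openin (top_of_set S) ((S \<inter> \<phi> -` (- C)) \<inter> (S \<inter> N))"
      by (rule openin_Int)
    moreover have "z \<in> (S \<inter> \<phi> -` (- C)) \<inter> (S \<inter> N)"
      using z N by (auto simp: C_def)
    moreover have "(S \<inter> \<phi> -` (- C)) \<inter> (S \<inter> N) \<subseteq> {x \<in> S. \<phi> x \<in> U}"
    proof clarsimp
      fix z' assume z': "z' \<in> S" "z' \<in> N" "\<phi> z' \<notin> C"
      have "{v. \<phi> z' v \<noteq> 0} \<in> K" "\<phi> z' \<in> simplex_realization {v. \<phi> z' v \<noteq> 0}"
        using geometric_realization_support[OF K im[OF z'(1)]] by auto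
      moreover have "{v. \<phi> z' v \<noteq> 0} \<subseteq> F" using N(4) z' by blast
      ultimately show "\<phi> z' \<in> U"
        using z'(3) unfolding C_def by blast
    qed
    ultimately show "\<exists>T. openin (top_of_set S) T \<and> z \<in> T \<and> T \<subseteq> {x \<in> S. \<phi> x \<in> U}"
      by blast
  qed
qed

lemma continuous_map_from_geometric_realization:
  assumes "\<And>\<sigma>. \<sigma> \<in> K \<Longrightarrow> continuous_map (top_of_set (simplex_realization \<sigma>)) Y \<phi>"
  shows "continuous_map (geometric_realization K) Y \<phi>"
  unfolding continuous_map_def
proof (intro conjI allI impI)
  show "\<phi> \<in> topspace (geometric_realization K) \<rightarrow> topspace Y"
    using assms by (auto simp: topspace_geometric_realization continuous_map_def)
  fix U assume "openin Y U"
  then have "openin (top_of_set (simplex_realization \<sigma>)) {x \<in> simplex_realization \<sigma>. \<phi> x \<in> U}"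
    if "\<sigma> \<in> K" for \<sigma>
    using assms[OF that] by (simp add: continuous_map_def)
  moreover have "{x \<in> topspace (geometric_realization K). \<phi> x \<in> U} \<inter> simplex_realization \<sigma> =
      {x \<in> simplex_realization \<sigma>. \<phi> x \<in> U}" if "\<sigma> \<in> K" for \<sigma>
    using that by (auto simp: topspace_geometric_realization)
  ultimately show "openin (geometric_realization K) {x \<in> topspace (geometric_realization K). \<phi> x \<in> U}"
    by (auto simp: openin_geometric_realization subtopology_powertop_real topspace_geometric_realization)
qed

text \<open>The product with the unit interval carries the weak topology too, by the tube lemma.\<close>

lemma openin_prod_geometric_realization:
  fixes W :: "(real \<times> ('v \<Rightarrow> real)) set"
  assumes sub: "W \<subseteq> {0..1} \<times> topspace (geometric_realization K)"
    and W: "\<And>\<sigma>. \<sigma> \<in> K \<Longrightarrow>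
      openin (top_of_set ({0..1} \<times> simplex_realization \<sigma>)) (W \<inter> ({0..1} \<times> simplex_realization \<sigma>))"
  shows "openin (prod_topology (top_of_set {0..1}) (geometric_realization K)) W"
proof (subst openin_subopen, clarify)
  fix s0 :: real and t0 :: "'v \<Rightarrow> real" assume st: "(s0, t0) \<in> W"
  then obtain \<sigma>0 where \<sigma>0: "\<sigma>0 \<in> K" "t0 \<in> simplex_realization \<sigma>0"
    using sub by (auto simp: topspace_geometric_realization)
  \<comment> \<open>The slice of \<open>W\<close> over \<open>t0\<close> is open and so contains a
    compact interval \<open>J\<close> about \<open>s0\<close>, the compact factor for the tube
    lemma.\<close>
  define A where "A = {0..1} \<inter> (\<lambda>s. (s, t0)) -` (W \<inter> ({0..1} \<times> simplex_realization \<sigma>0))"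
  have "openin (top_of_set {0..1}) A"
    unfolding A_def using \<sigma>0 by (intro continuous_openin_preimage[OF _ _ W[OF \<sigma>0(1)]] continuous_intros) auto
  moreover have "s0 \<in> A"
    using st sub \<sigma>0 by (auto simp: A_def)
  ultimately obtain e where e: "0 < e" "cball s0 e \<inter> {0..1} \<subseteq> A"
    unfolding openin_contains_cball by blast
  define J where "J = cball s0 e \<inter> {0..1}"
  define V where "V = {t \<in> topspace (geometric_realization K). \<forall>s\<in>J. (s, t) \<in> W}"
  have "compact J" unfolding J_def by (intro compact_Int_closed) auto
  have "openin (top_of_set (simplex_realization \<sigma>)) (V \<inter> simplex_realization \<sigma>)" if \<sigma>: "\<sigma> \<in> K" for \<sigma>
  proof -
    let ?R = "simplex_realization \<sigma>"
    have J01: "J \<times> ?R \<subseteq> {0..1} \<times> ?R" by (auto simp: J_def)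
    have "openin (top_of_set (J \<times> ?R)) (W \<inter> (J \<times> ?R))"
    proof -
      obtain G where G: "open G" "W \<inter> ({0..1} \<times> ?R) = ({0..1} \<times> ?R) \<inter> G"
        using W[OF \<sigma>] by (auto simp: openin_open)
      then have "W \<inter> (J \<times> ?R) = (J \<times> ?R) \<inter> G" using J01 by blast
      with G(1) show ?thesis by (auto simp: openin_open)
    qed
    then have "closedin (top_of_set (J \<times> ?R)) (J \<times> ?R - W \<inter> (J \<times> ?R))"
      by (metis closedin_diff closedin_topspace topspace_euclidean_subtopology)
    \<comment> \<open>Projection along the compact factor \<open>J\<close> is a closed map.\<close>
    then have "closedin (top_of_set ?R) (snd ` (J \<times> ?R - W \<inter> (J \<times> ?R)))"
      using closed_map_snd[of "top_of_set J" "top_of_set ?R"] \<open>compact J\<close>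
      by (simp add: closed_map_def prod_topology_subtopology_eu compact_space_subtopology)
    then have "openin (top_of_set ?R) (?R - snd ` (J \<times> ?R - W \<inter> (J \<times> ?R)))"
      by (metis openin_diff openin_topspace topspace_euclidean_subtopology)
    moreover have "snd ` (J \<times> ?R - W \<inter> (J \<times> ?R)) = {t \<in> ?R. \<exists>s\<in>J. (s, t) \<notin> W}"
      by force
    moreover have "?R - {t \<in> ?R. \<exists>s\<in>J. (s, t) \<notin> W} = V \<inter> ?R"
      using \<sigma> unfolding V_def topspace_geometric_realization by blast
    ultimately show ?thesis by simp
  qed
  then have "openin (geometric_realization K) V"
    by (auto simp: openin_geometric_realization subtopology_powertop_real V_def
        topspace_geometric_realization)
  moreover have "openin (top_of_set {0..1}) ({0..1} \<inter> ball s0 e)"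
    by (simp add: openin_open_Int)
  ultimately have "openin (prod_topology (top_of_set {0..1}) (geometric_realization K))
      (({0..1} \<inter> ball s0 e) \<times> V)"
    by (simp add: openin_prod_Times_iff)
  moreover have "(s0, t0) \<in> ({0..1} \<inter> ball s0 e) \<times> V"
    using st sub e by (auto simp: V_def J_def A_def)
  moreover have "({0..1} \<inter> ball s0 e) \<times> V \<subseteq> W"
    by (auto simp: V_def J_def)
  ultimately show "\<exists>T. openin (prod_topology (top_of_set {0..1}) (geometric_realization K)) T \<and>
      (s0, t0) \<in> T \<and> T \<subseteq> W"
    by blast
qed

lemma continuous_map_from_prod_geometric_realization:
  assumes "\<And>\<sigma>. \<sigma> \<in> K \<Longrightarrow> continuous_map (top_of_set ({0..1::real} \<times> simplex_realization \<sigma>)) Y \<phi>"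
  shows "continuous_map (prod_topology (top_of_set {0..1}) (geometric_realization K)) Y \<phi>"
  unfolding continuous_map_def
proof (intro conjI allI impI)
  let ?P = "prod_topology (top_of_set {0..1::real}) (geometric_realization K)"
  have top: "topspace ?P = {0..1} \<times> (\<Union>\<sigma>\<in>K. simplex_realization \<sigma>)"
    by (simp add: topspace_geometric_realization)
  show "\<phi> \<in> topspace ?P \<rightarrow> topspace Y"
    using assms unfolding top continuous_map_def by force
  fix U assume "openin Y U"
  then have "openin (top_of_set ({0..1} \<times> simplex_realization \<sigma>))
      {x \<in> {0..1} \<times> simplex_realization \<sigma>. \<phi> x \<in> U}" if "\<sigma> \<in> K" for \<sigma>
    using assms[OF that] by (simp add: continuous_map_def)
  moreover have "{x \<in> topspace ?P. \<phi> x \<in> U} \<inter> ({0..1} \<times> simplex_realization \<sigma>) =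
      {x \<in> {0..1} \<times> simplex_realization \<sigma>. \<phi> x \<in> U}" if "\<sigma> \<in> K" for \<sigma>
    using that unfolding top by auto
  ultimately show "openin ?P {x \<in> topspace ?P. \<phi> x \<in> U}"
    by (intro openin_prod_geometric_realization) auto
qed

text \<open>The segment from \<open>a t\<close> to \<open>b t\<close> stays in the common simplex.
  The support of a convex combination lies in the union of the two supports, so local finiteness
  passes to the homotopy.\<close>

lemma homotopic_linear_geometric_realization:
  assumes K: "abstract_simplicial_complex K"
    and cont: "\<And>\<sigma>. \<sigma> \<in> K \<Longrightarrow> continuous_on (simplex_realization \<sigma>) a"
      "\<And>\<sigma>. \<sigma> \<in> K \<Longrightarrow> continuous_on (simplex_realization \<sigma>) b"
    and lf: "\<And>\<sigma>. \<sigma> \<in> K \<Longrightarrow> locally_finite_support (simplex_realization \<sigma>) a"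
      "\<And>\<sigma>. \<sigma> \<in> K \<Longrightarrow> locally_finite_support (simplex_realization \<sigma>) b"
    and common: "\<And>t. t \<in> topspace (geometric_realization K) \<Longrightarrow>
      \<exists>\<rho>\<in>K. a t \<in> simplex_realization \<rho> \<and> b t \<in> simplex_realization \<rho>"
  shows "homotopic_with (\<lambda>_. True) (geometric_realization K) (geometric_realization K) a b"
proof -
  define H where "H w = (\<lambda>v. (1 - fst w) * a (snd w) v + fst w * b (snd w) v)" for w :: "real \<times> _"
  have "continuous_map (prod_topology (top_of_set {0..1}) (geometric_realization K))
      (geometric_realization K) H"
  proof (intro continuous_map_from_prod_geometric_realization continuous_map_into_geometric_realization[OF K])
    fix \<sigma> assume \<sigma>: "\<sigma> \<in> K"
    let ?Z = "{0..1::real} \<times> simplex_realization \<sigma>"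
    have snd: "continuous_on ?Z snd" "snd ` ?Z \<subseteq> simplex_realization \<sigma>"
      by (auto intro: continuous_intros)
    note comp = continuous_on_compose2[OF cont(1)[OF \<sigma>] snd] continuous_on_compose2[OF cont(2)[OF \<sigma>] snd]
    show "continuous_on ?Z H"
      unfolding H_def
      by (intro continuous_on_coordinatewise_then_product continuous_intros
          continuous_on_product_then_coordinatewise[OF comp(1)]
          continuous_on_product_then_coordinatewise[OF comp(2)])
    note lf' = locally_finite_support_compose[OF lf(1)[OF \<sigma>] snd] locally_finite_support_compose[OF lf(2)[OF \<sigma>] snd]
    show "locally_finite_support ?Z H"
      unfolding locally_finite_support_def
    proof
      fix z assume z: "z \<in> ?Z"
      obtain N F where N: "open N" "z \<in> N" "finite F"
          "\<And>z' v. z' \<in> ?Z \<inter> N \<Longrightarrow> a (snd z') v \<noteq> 0 \<Longrightarrow> v \<in> F"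
        using lf'(1) z unfolding locally_finite_support_def by metis
      obtain M G where M: "open M" "z \<in> M" "finite G"
          "\<And>z' v. z' \<in> ?Z \<inter> M \<Longrightarrow> b (snd z') v \<noteq> 0 \<Longrightarrow> v \<in> G"
        using lf'(2) z unfolding locally_finite_support_def by metis
      have "v \<in> F \<union> G" if "z' \<in> ?Z \<inter> (N \<inter> M)" "H z' v \<noteq> 0" for z' v
      proof -
        have "a (snd z') v \<noteq> 0 \<or> b (snd z') v \<noteq> 0" using that(2) by (auto simp: H_def)
        then show ?thesis using N(4) M(4) that(1) by blast
      qed
      then show "\<exists>N F. open N \<and> z \<in> N \<and> finite F \<and> (\<forall>z'\<in>?Z \<inter> N. \<forall>v. H z' v \<noteq> 0 \<longrightarrow> v \<in> F)"
        using N M by (intro exI[of _ "N \<inter> M"] exI[of _ "F \<union> G"]) auto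
    qed
    fix z assume z: "z \<in> ?Z"
    then obtain \<rho> where "\<rho> \<in> K" "a (snd z) \<in> simplex_realization \<rho>" "b (snd z) \<in> simplex_realization \<rho>"
      using common[of "snd z"] \<sigma> unfolding topspace_geometric_realization by (metis UN_I mem_Times_iff)
    then have "H z \<in> simplex_realization \<rho>"
      unfolding H_def using z by (intro convex_simplex_realization) auto
    then show "H z \<in> topspace (geometric_realization K)"
      using \<open>\<rho> \<in> K\<close> by (auto simp: topspace_geometric_realization)
  qed
  then show ?thesis
    unfolding homotopic_with_def by (intro exI[of _ H]) (auto simp: H_def)
qed

subsection \<open>The nerve of a cover\<close>

text \<open>A partition of unity on a locally finite refinement is indexed by open sets. Each such
  set \<open>W\<close> is assigned one index \<open>i W\<close> with
  \<open>W \<subseteq> G (i W)\<close>, and the functions assigned to the same index are added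
  up.\<close>

lemma indexed_partition_of_unity:
  fixes S :: "'a::{metric_space,second_countable_topology} set" and G :: "'v \<Rightarrow> 'a set"
  assumes cover: "S \<subseteq> (\<Union>v\<in>P. G v)" and op: "\<And>v. v \<in> P \<Longrightarrow> open (G v)"
  obtains f :: "'a \<Rightarrow> 'v \<Rightarrow> real" where "continuous_on S f" "locally_finite_support S f"
    "\<And>y v. y \<in> S \<Longrightarrow> f y v \<noteq> 0 \<Longrightarrow> v \<in> P \<and> y \<in> G v"
    "\<And>y. y \<in> S \<Longrightarrow> finite {v. f y v \<noteq> 0}"
    "\<And>y. y \<in> S \<Longrightarrow> f y \<in> simplex_realization {v. f y v \<noteq> 0}"
proof -
  obtain \<C> where \<C>: "S \<subseteq> \<Union>\<C>" "\<And>U. U \<in> \<C> \<Longrightarrow> open U \<and> (\<exists>T. T \<in> G ` P \<and> U \<subseteq> T)"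
      "\<And>x. x \<in> S \<Longrightarrow> \<exists>V. open V \<and> x \<in> V \<and> finite {U. U \<in> \<C> \<and> U \<inter> V \<noteq> {}}"
    by (rule paracompact[of S "G ` P"]) (use cover op in blast)+
  have "\<exists>v. v \<in> P \<and> U \<subseteq> G v" if "U \<in> \<C>" for U
    using \<C>(2)[OF that] by blast
  then obtain i where i: "\<And>U. U \<in> \<C> \<Longrightarrow> i U \<in> P \<and> U \<subseteq> G (i U)"
    by metis
  obtain F :: "'a set \<Rightarrow> 'a \<Rightarrow> real" where
      F: "\<And>U. U \<in> \<C> \<Longrightarrow> continuous_on S (F U) \<and> (\<forall>x \<in> S. 0 \<le> F U x)"
        "\<And>x U. \<lbrakk>U \<in> \<C>; x \<in> S; x \<notin> U\<rbrakk> \<Longrightarrow> F U x = 0"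
        "\<And>x. x \<in> S \<Longrightarrow> supp_sum (\<lambda>W. F W x) \<C> = 1"
        "\<And>x. x \<in> S \<Longrightarrow> \<exists>V. open V \<and> x \<in> V \<and> finite {U \<in> \<C>. \<exists>x\<in>V. F U x \<noteq> 0}"
  proof (rule subordinate_partition_of_unity[OF \<C>(1)])
    show "open T" if "T \<in> \<C>" for T
      using \<C>(2)[OF that] by simp
  qed (use \<C>(3) in auto)
  define A where "A y = {W \<in> \<C>. F W y \<noteq> 0}" for y
  define f where "f y v = (\<Sum>W \<in> {W. W \<in> A y \<and> i W = v}. F W y)" for y v
  have finA: "finite (A y)" if y: "y \<in> S" for y
  proof -
    obtain V where V: "y \<in> V" "finite {U \<in> \<C>. \<exists>x\<in>V. F U x \<noteq> 0}"
      using F(4)[OF y] by blast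
    show ?thesis
      by (rule finite_subset[OF _ V(2)]) (use V(1) in \<open>auto simp: A_def\<close>)
  qed
  have supp: "{v. f y v \<noteq> 0} \<subseteq> i ` A y" for y
  proof (rule subsetI, rule ccontr)
    fix v assume v: "v \<in> {v. f y v \<noteq> 0}" "v \<notin> i ` A y"
    then have "{W. W \<in> A y \<and> i W = v} = {}" by blast
    then have "f y v = 0" unfolding f_def by (simp only: sum.empty)
    with v(1) show False by simp
  qed
  \<comment> \<open>On \<open>V\<close> the index set varying with the point is replaced by a fixed
    finite one, from which continuity can be read off.\<close>
  have local: "f y' v = (\<Sum>W \<in> {W \<in> B. i W = v}. F W y')"
    if "B = {U \<in> \<C>. \<exists>x\<in>V. F U x \<noteq> 0}" "finite B" "y' \<in> V" for B V y' v
    unfolding f_def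
  proof (rule sum.mono_neutral_left)
    show "finite {W \<in> B. i W = v}" using that(2) by simp
  qed (use that in \<open>auto simp: A_def\<close>)
  have cont: "continuous_on S (\<lambda>y. f y v)" for v
    unfolding continuous_on_eq_continuous_within
  proof
    fix y assume y: "y \<in> S"
    obtain V where V: "open V" "y \<in> V" "finite {U \<in> \<C>. \<exists>x\<in>V. F U x \<noteq> 0}"
      using F(4)[OF y] by blast
    let ?B = "{U \<in> \<C>. \<exists>x\<in>V. F U x \<noteq> 0}"
    have "continuous_on (S \<inter> V) (\<lambda>y. \<Sum>W \<in> {W \<in> ?B. i W = v}. F W y)"
      using F(1) by (intro continuous_on_sum) (auto intro: continuous_on_subset)
    then have "continuous_on (S \<inter> V) (\<lambda>y. f y v)"
      by (rule continuous_on_eq) (use local[OF refl V(3)] in simp)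
    then have "continuous (at y within S \<inter> V) (\<lambda>y. f y v)"
      using y V by (simp add: continuous_on_eq_continuous_within)
    moreover have "at y within S \<inter> V = at y within S"
      using V by (intro at_within_nhd[of y V]) auto
    ultimately show "continuous (at y within S) (\<lambda>y. f y v)" by simp
  qed
  show ?thesis
  proof (rule that)
    show "continuous_on S f"
      using cont by (rule continuous_on_coordinatewise_then_product)
    show "locally_finite_support S f"
      unfolding locally_finite_support_def
    proof
      fix y assume y: "y \<in> S"
      obtain V where V: "open V" "y \<in> V" "finite {U \<in> \<C>. \<exists>x\<in>V. F U x \<noteq> 0}"
        using F(4)[OF y] by blast
      have "\<forall>z\<in>S \<inter> V. \<forall>v. f z v \<noteq> 0 \<longrightarrow> v \<in> i ` {U \<in> \<C>. \<exists>x\<in>V. F U x \<noteq> 0}"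
        using supp by (fastforce simp: A_def)
      then show "\<exists>N F. open N \<and> y \<in> N \<and> finite F \<and> (\<forall>z\<in>S \<inter> N. \<forall>v. f z v \<noteq> 0 \<longrightarrow> v \<in> F)"
        using V by (intro exI[of _ V] exI[of _ "i ` {U \<in> \<C>. \<exists>x\<in>V. F U x \<noteq> 0}"]) auto
    qed
  next
    fix y assume y: "y \<in> S"
    show fin: "finite {v. f y v \<noteq> 0}"
      using finite_subset[OF supp] finA[OF y] by blast
    have "sum (f y) {v. f y v \<noteq> 0} = sum (f y) (i ` A y)"
      using supp finA[OF y] by (intro sum.mono_neutral_left) auto
    also have "\<dots> = (\<Sum>W\<in>A y. F W y)"
      unfolding f_def by (rule sum.image_gen[symmetric, OF finA[OF y]])
    also have "\<dots> = 1"
      using F(3)[OF y] by (simp add: supp_sum_def support_on_def A_def)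
    finally have "sum (f y) {v. f y v \<noteq> 0} = 1" .
    moreover have "0 \<le> f y v" for v
      unfolding f_def using F(1) y by (intro sum_nonneg) (auto simp: A_def)
    ultimately show "f y \<in> simplex_realization {v. f y v \<noteq> 0}"
      by (simp add: simplex_realization_def)
  next
    fix y v assume y: "y \<in> S" "f y v \<noteq> 0"
    then obtain W where W: "W \<in> \<C>" "F W y \<noteq> 0" "i W = v"
      using supp[of y] by (auto simp: A_def)
    then have "y \<in> W" using F(2) y by blast
    with W i[of W] show "v \<in> P \<and> y \<in> G v" by blast
  qed
qed

text \<open>Half the sum of squares is continuous on each simplex and, as the coordinates sum to 1,
  strictly below the largest coordinate.\<close>

definition threshold :: "('v \<Rightarrow> real) \<Rightarrow> real" where
  "threshold t = (\<Sum>v | t v \<noteq> 0. (t v)\<^sup>2) / 2"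

text \<open>The support jumps as \<open>t\<close> varies, whereas \<open>\<rho>\<close> is fixed, so
  continuity on a closed simplex becomes visible. \<open>peak_eq\<close> and
  \<open>spread_eq\<close> serve the same purpose.\<close>

lemma threshold_eq:
  assumes "t \<in> simplex_realization \<rho>" "finite \<rho>"
  shows "threshold t = (\<Sum>v\<in>\<rho>. (t v)\<^sup>2) / 2"
  unfolding threshold_def using simplex_realization_support(1)[OF assms] assms(2)
  by (intro arg_cong[where f = "\<lambda>x. x / 2"] sum.mono_neutral_left) auto

lemma threshold_pos:
  assumes "t \<in> simplex_realization \<rho>" "finite \<rho>"
  shows "0 < threshold t"
proof -
  obtain v where v: "t v \<noteq> 0" "v \<in> \<rho>"
    using simplex_realization_support[OF assms] by blast
  then have "0 < (\<Sum>v\<in>\<rho>. (t v)\<^sup>2)"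
    using assms(2) by (intro sum_pos2[of _ v]) auto
  then show ?thesis using threshold_eq[OF assms] by simp
qed

lemma threshold_exceeded:
  assumes t: "t \<in> simplex_realization \<rho>" "finite \<rho>"
  obtains v where "v \<in> \<rho>" "threshold t < t v"
proof (rule ccontr)
  assume "\<not> thesis"
  then have le: "t v \<le> threshold t" if "v \<in> \<rho>" for v
    using that \<open>\<And>v. v \<in> \<rho> \<Longrightarrow> threshold t < t v \<Longrightarrow> thesis\<close> by force
  \<comment> \<open>The left side is twice the threshold, so the bound contradicts
    positivity.\<close>
  have "(\<Sum>v\<in>\<rho>. (t v)\<^sup>2) \<le> (\<Sum>v\<in>\<rho>. threshold t * t v)"
    using t le by (intro sum_mono) (auto simp: power2_eq_square simplex_realization_def intro!: mult_right_mono)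
  also have "\<dots> = threshold t"
    using t by (simp add: simplex_realization_def flip: sum_distrib_left)
  finally show False
    using threshold_eq[OF t] threshold_pos[OF t] by simp
qed

lemma continuous_on_threshold:
  assumes "finite \<rho>"
  shows "continuous_on (simplex_realization \<rho>) threshold"
proof -
  have "continuous_on (simplex_realization \<rho>) (\<lambda>t. (\<Sum>v\<in>\<rho>. (t v)\<^sup>2) / 2)"
    by (intro continuous_intros continuous_on_coordinate) auto
  then show ?thesis
    by (rule continuous_on_eq) (simp only: threshold_eq[OF _ assms])
qed

text \<open>The truncation of \<open>t\<close> at the threshold, renormalised to barycentric
  coordinates. Subtracting the threshold, rather than cutting off, keeps it continuous on each
  simplex.\<close>

definition peak :: "('v \<Rightarrow> real) \<Rightarrow> 'v \<Rightarrow> real" where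
  "peak t v = max 0 (t v - threshold t) / (\<Sum>v | t v \<noteq> 0. max 0 (t v - threshold t))"

lemma peak_eq:
  assumes t: "t \<in> simplex_realization \<rho>" "finite \<rho>"
  shows "peak t v = max 0 (t v - threshold t) / (\<Sum>v\<in>\<rho>. max 0 (t v - threshold t))"
proof -
  have "(\<Sum>v | t v \<noteq> 0. max 0 (t v - threshold t)) = (\<Sum>v\<in>\<rho>. max 0 (t v - threshold t))"
    using simplex_realization_support(1)[OF t] threshold_pos[OF t] t(2)
    by (intro sum.mono_neutral_left) auto
  then show ?thesis by (simp add: peak_def)
qed

lemma peak_denominator_pos:
  assumes t: "t \<in> simplex_realization \<rho>" "finite \<rho>"
  shows "0 < (\<Sum>v\<in>\<rho>. max 0 (t v - threshold t))"
proof -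
  obtain v where "v \<in> \<rho>" "threshold t < t v" using threshold_exceeded[OF t] .
  then show ?thesis using t(2) by (intro sum_pos2[of _ v]) auto
qed

lemma peak_nonzero:
  assumes "peak t v \<noteq> 0"
  shows "threshold t < t v"
  using assms by (auto simp: peak_def max_def split: if_splits)

lemma peak_in_simplex:
  assumes t: "t \<in> simplex_realization \<rho>" "finite \<rho>"
  shows "peak t \<in> simplex_realization \<rho>"
proof -
  have "peak t v = 0" if "v \<notin> \<rho>" for v
    using peak_nonzero[of t v] threshold_pos[OF t] t that by (force simp: simplex_realization_def)
  moreover have "sum (peak t) \<rho> = 1"
    using peak_denominator_pos[OF t] unfolding peak_eq[OF t] by (simp flip: sum_divide_distrib)
  moreover have "0 \<le> peak t v" for v
    using peak_denominator_pos[OF t] unfolding peak_eq[OF t] by simp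
  ultimately show ?thesis by (simp add: simplex_realization_def)
qed

lemma continuous_on_peak:
  assumes "finite \<rho>"
  shows "continuous_on (simplex_realization \<rho>) peak"
proof (rule continuous_on_coordinatewise_then_product)
  fix v
  have "continuous_on (simplex_realization \<rho>)
      (\<lambda>t. max 0 (t v - threshold t) / (\<Sum>v\<in>\<rho>. max 0 (t v - threshold t)))"
    by (intro continuous_intros continuous_on_coordinate continuous_on_threshold assms ballI
        less_imp_neq[THEN not_sym] peak_denominator_pos)
  then show "continuous_on (simplex_realization \<rho>) (\<lambda>t. peak t v)"
    by (rule continuous_on_eq) (simp only: peak_eq[OF _ assms])
qed

section \<open>Weighted means of points attached to faces\<close>

text \<open>The first product excludes faces with a vertex of coordinate 0, the second those
  omitting a vertex at or above the threshold. The empty face thus has weight 0 on a simplex,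
  because some coordinate exceeds the threshold.\<close>

definition face_weight :: "'v set \<Rightarrow> ('v \<Rightarrow> real) \<Rightarrow> 'v set \<Rightarrow> real" where
  "face_weight \<rho> t \<sigma> = (\<Prod>v\<in>\<sigma>. t v) * (\<Prod>v\<in>\<rho> - \<sigma>. max 0 (1 - t v / threshold t))"

text \<open>Summing over faces of the support makes the value depend on \<open>t\<close> alone, so
  the formulas on different simplices agree automatically.\<close>

definition spread :: "('v set \<Rightarrow> 'a::real_vector) \<Rightarrow> ('v \<Rightarrow> real) \<Rightarrow> 'a" where
  "spread y t = (let \<rho> = {v. t v \<noteq> 0} in
     (1 / (\<Sum>\<sigma>\<in>Pow \<rho>. face_weight \<rho> t \<sigma>)) *\<^sub>R (\<Sum>\<sigma>\<in>Pow \<rho>. face_weight \<rho> t \<sigma> *\<^sub>R y \<sigma>))"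

text \<open>A vertex with coordinate 0 contributes the factor \<open>1 - 0\<close> to the second
  product.\<close>

lemma face_weight_support:
  assumes t: "t \<in> simplex_realization \<rho>" "finite \<rho>" and \<sigma>: "\<sigma> \<subseteq> {v. t v \<noteq> 0}"
  shows "face_weight {v. t v \<noteq> 0} t \<sigma> = face_weight \<rho> t \<sigma>"
proof -
  have "(\<Prod>v\<in>{v. t v \<noteq> 0} - \<sigma>. max 0 (1 - t v / threshold t)) = (\<Prod>v\<in>\<rho> - \<sigma>. max 0 (1 - t v / threshold t))"
  proof (rule prod.mono_neutral_left)
    show "{v. t v \<noteq> 0} - \<sigma> \<subseteq> \<rho> - \<sigma>"
      using simplex_realization_support(1)[OF t] by blast
  qed (use t(2) in auto)
  then show ?thesis by (simp add: face_weight_def)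
qed

lemma face_weight_nonneg:
  assumes "t \<in> simplex_realization \<rho>"
  shows "0 \<le> face_weight \<rho> t \<sigma>"
  using assms unfolding face_weight_def
  by (intro mult_nonneg_nonneg prod_nonneg) (auto simp: simplex_realization_def)

lemma face_weight_nonzero:
  assumes t: "t \<in> simplex_realization \<rho>" "finite \<rho>" and \<sigma>: "\<sigma> \<subseteq> \<rho>" "face_weight \<rho> t \<sigma> \<noteq> 0"
  shows "\<sigma> \<subseteq> {v. t v \<noteq> 0}" "\<And>v. threshold t < t v \<Longrightarrow> v \<in> \<sigma>"
proof -
  have fin: "finite \<sigma>" using t(2) \<sigma>(1) by (rule rev_finite_subset)
  show "\<sigma> \<subseteq> {v. t v \<noteq> 0}"
    using \<sigma>(2) fin by (auto simp: face_weight_def)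
  fix v assume v: "threshold t < t v"
  then have "v \<in> \<rho>" using t(1) threshold_pos[OF t] by (force simp: simplex_realization_def)
  show "v \<in> \<sigma>"
  proof (rule ccontr)
    assume "v \<notin> \<sigma>"
    then have "max 0 (1 - t v / threshold t) \<noteq> 0"
      using \<sigma>(2) \<open>v \<in> \<rho>\<close> t(2) by (auto simp: face_weight_def)
    then show False using v threshold_pos[OF t] by (simp add: max_def field_simps split: if_splits)
  qed
qed

text \<open>The whole support is a face of positive weight: its coordinates are positive, and no
  vertex of the support is left over to supply a vanishing factor.\<close>

lemma face_weight_sum_pos:
  assumes t: "t \<in> simplex_realization \<rho>" "finite \<rho>"
  shows "0 < (\<Sum>\<sigma>\<in>Pow \<rho>. face_weight \<rho> t \<sigma>)"
proof (rule sum_pos2)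
  show "{v. t v \<noteq> 0} \<in> Pow \<rho>" using simplex_realization_support(1)[OF t] by simp
  have "0 < (\<Prod>v | t v \<noteq> 0. t v)"
    using t(1) by (intro prod_pos) (auto simp: simplex_realization_def less_le)
  then have "0 < face_weight {v. t v \<noteq> 0} t {v. t v \<noteq> 0}"
    by (simp add: face_weight_def)
  then show "0 < face_weight \<rho> t {v. t v \<noteq> 0}"
    using face_weight_support[OF t] by simp
qed (use t face_weight_nonneg in auto)

lemma spread_eq:
  assumes t: "t \<in> simplex_realization \<rho>" "finite \<rho>"
  shows "spread y t = (1 / (\<Sum>\<sigma>\<in>Pow \<rho>. face_weight \<rho> t \<sigma>)) *\<^sub>R (\<Sum>\<sigma>\<in>Pow \<rho>. face_weight \<rho> t \<sigma> *\<^sub>R y \<sigma>)"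
proof -
  let ?S = "{v. t v \<noteq> 0}"
  have zero: "face_weight \<rho> t \<sigma> = 0" if "\<sigma> \<in> Pow \<rho> - Pow ?S" for \<sigma>
    using face_weight_nonzero(1)[OF t, of \<sigma>] that by blast
  have sub: "Pow ?S \<subseteq> Pow \<rho>" using simplex_realization_support(1)[OF t] by auto
  have "(\<Sum>\<sigma>\<in>Pow ?S. face_weight ?S t \<sigma>) = (\<Sum>\<sigma>\<in>Pow ?S. face_weight \<rho> t \<sigma>)"
    using face_weight_support[OF t] by (intro sum.cong) auto
  also have "\<dots> = (\<Sum>\<sigma>\<in>Pow \<rho>. face_weight \<rho> t \<sigma>)"
    using sub zero t(2) by (intro sum.mono_neutral_left) auto
  finally have 1: "(\<Sum>\<sigma>\<in>Pow ?S. face_weight ?S t \<sigma>) = (\<Sum>\<sigma>\<in>Pow \<rho>. face_weight \<rho> t \<sigma>)" .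
  have "(\<Sum>\<sigma>\<in>Pow ?S. face_weight ?S t \<sigma> *\<^sub>R y \<sigma>) = (\<Sum>\<sigma>\<in>Pow ?S. face_weight \<rho> t \<sigma> *\<^sub>R y \<sigma>)"
    using face_weight_support[OF t] by (intro sum.cong) auto
  also have "\<dots> = (\<Sum>\<sigma>\<in>Pow \<rho>. face_weight \<rho> t \<sigma> *\<^sub>R y \<sigma>)"
    using sub zero t(2) by (intro sum.mono_neutral_left) auto
  finally show ?thesis using 1 by (simp add: spread_def Let_def)
qed

lemma continuous_on_spread:
  fixes y :: "'v set \<Rightarrow> 'a::real_normed_vector"
  assumes "finite \<rho>"
  shows "continuous_on (simplex_realization \<rho>) (spread y)"
proof -
  let ?R = "simplex_realization \<rho>"
  have w: "continuous_on ?R (\<lambda>t. face_weight \<rho> t \<sigma>)" for \<sigma>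
    unfolding face_weight_def
    by (intro continuous_intros continuous_on_coordinate continuous_on_threshold assms ballI
        less_imp_neq[THEN not_sym] threshold_pos[OF _ assms])
  have "continuous_on ?R (\<lambda>t. (1 / (\<Sum>\<sigma>\<in>Pow \<rho>. face_weight \<rho> t \<sigma>)) *\<^sub>R
      (\<Sum>\<sigma>\<in>Pow \<rho>. face_weight \<rho> t \<sigma> *\<^sub>R y \<sigma>))"
    by (intro continuous_intros w ballI less_imp_neq[THEN not_sym] face_weight_sum_pos assms)
  then show ?thesis
    by (rule continuous_on_eq) (simp only: spread_eq[OF _ assms])
qed

text \<open>Every face of non-zero weight contains \<open>v\<close>, so only points of
  \<open>C\<close> are averaged.\<close>

lemma spread_in_convex_hull:
  assumes t: "t \<in> simplex_realization \<rho>" "finite \<rho>" and v: "threshold t < t v"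
    and y: "\<And>\<sigma>. \<sigma> \<subseteq> \<rho> \<Longrightarrow> v \<in> \<sigma> \<Longrightarrow> y \<sigma> \<in> C"
  shows "spread y t \<in> convex hull C"
proof -
  let ?w = "face_weight \<rho> t"
  let ?A = "{\<sigma> \<in> Pow \<rho>. ?w \<sigma> \<noteq> 0}"
  have fin: "finite (Pow \<rho>)" using t(2) by simp
  have 1: "sum ?w (Pow \<rho>) = sum ?w ?A"
    using fin by (intro sum.mono_neutral_right) auto
  have 2: "(\<Sum>\<sigma>\<in>Pow \<rho>. ?w \<sigma> *\<^sub>R y \<sigma>) = (\<Sum>\<sigma>\<in>?A. ?w \<sigma> *\<^sub>R y \<sigma>)"
    using fin by (intro sum.mono_neutral_right) auto
  have pos: "0 < sum ?w ?A" using face_weight_sum_pos[OF t] 1 by simp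
  have "spread y t = (\<Sum>\<sigma>\<in>?A. (?w \<sigma> / sum ?w ?A) *\<^sub>R y \<sigma>)"
    unfolding spread_eq[OF t] 1 2 by (simp add: scaleR_sum_right)
  also have "\<dots> \<in> convex hull C"
  proof (rule convex_sum)
    show "(\<Sum>\<sigma>\<in>?A. ?w \<sigma> / sum ?w ?A) = 1"
      using pos by (simp flip: sum_divide_distrib)
    show "0 \<le> ?w \<sigma> / sum ?w ?A" for \<sigma>
      using face_weight_nonneg[OF t(1)] pos by simp
    show "y \<sigma> \<in> convex hull C" if "\<sigma> \<in> ?A" for \<sigma>
      using y[of \<sigma>] face_weight_nonzero(2)[OF t _ _ v, of \<sigma>] that by (auto intro: hull_inc)
  qed (use fin in auto)
  finally show ?thesis .
qed

text \<open>A nerve theorem in which a projection stands in for convexity of the cover: a segment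
  between two points of one \<open>U v\<close> is carried by \<open>\<pi>\<close> to a path inside
  \<open>U v\<close>.\<close>

lemma nerve_homotopy_equivalence:
  fixes X T :: "'a::euclidean_space set" and U G :: "'v \<Rightarrow> 'a set" and P :: "'v set"
  assumes op: "\<And>v. v \<in> P \<Longrightarrow> open (G v)" and U: "\<And>v. v \<in> P \<Longrightarrow> U v = X \<inter> G v"
    and \<pi>: "continuous_on T \<pi>" "\<And>y. y \<in> X \<Longrightarrow> \<pi> y = y"
    and hull: "\<And>v. v \<in> P \<Longrightarrow> convex hull (U v) \<subseteq> T"
      "\<And>v z. v \<in> P \<Longrightarrow> z \<in> convex hull (U v) \<Longrightarrow> \<pi> z \<in> U v"
  defines "K \<equiv> {\<sigma>. finite \<sigma> \<and> \<sigma> \<noteq> {} \<and> \<sigma> \<subseteq> P \<and> (\<Inter>v\<in>\<sigma>. U v) \<noteq> {}}"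
  shows "top_of_set (\<Union>v\<in>P. U v) homotopy_equivalent_space geometric_realization K"
proof -
  define S where "S = (\<Union>v\<in>P. U v)"
  let ?R = "geometric_realization K"
  have K: "abstract_simplicial_complex K"
    unfolding abstract_simplicial_complex_def K_def by (auto intro: finite_subset) blast
  have finK: "finite \<rho>" if "\<rho> \<in> K" for \<rho> using that by (simp add: K_def)
  have "\<exists>y. y \<in> (\<Inter>v\<in>\<sigma>. U v)" if "\<sigma> \<in> K" for \<sigma>
    using that unfolding K_def by blast
  \<comment> \<open>Outside \<open>K\<close> the value of \<open>y\<close> is arbitrary; on
    simplices of \<open>K\<close> such faces enter \<open>spread y\<close> only with weight
    0.\<close>
  then obtain y where y: "\<And>\<sigma>. \<sigma> \<in> K \<Longrightarrow> y \<sigma> \<in> (\<Inter>v\<in>\<sigma>. U v)" by metis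
  have SX: "S \<subseteq> X" using U by (auto simp: S_def)
  have cover: "S \<subseteq> (\<Union>v\<in>P. G v)" using U by (auto simp: S_def)
  obtain f :: "'a \<Rightarrow> 'v \<Rightarrow> real" where f: "continuous_on S f" "locally_finite_support S f"
      "\<And>z v. z \<in> S \<Longrightarrow> f z v \<noteq> 0 \<Longrightarrow> v \<in> P \<and> z \<in> G v"
      "\<And>z. z \<in> S \<Longrightarrow> finite {v. f z v \<noteq> 0}"
      "\<And>z. z \<in> S \<Longrightarrow> f z \<in> simplex_realization {v. f z v \<noteq> 0}"
    by (rule indexed_partition_of_unity[OF cover op]) blast+
  have fU: "v \<in> P" "z \<in> U v" if "z \<in> S" "f z v \<noteq> 0" for z v
    using f(3)[OF that] U SX that(1) by auto
  have f_supp: "{v. f z v \<noteq> 0} \<in> K" if z: "z \<in> S" for z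
  proof -
    have "{v. f z v \<noteq> 0} \<noteq> {}"
      using simplex_realization_support(2)[OF f(5)[OF z] f(4)[OF z]] .
    moreover have "z \<in> (\<Inter>v\<in>{v. f z v \<noteq> 0}. U v)" using fU(2)[OF z] by blast
    ultimately show ?thesis
      unfolding K_def using fU(1)[OF z] f(4)[OF z] by blast
  qed
  have cont_f: "continuous_map (top_of_set S) ?R f"
    using f_supp f(5)
    by (intro continuous_map_into_geometric_realization K f) (auto simp: topspace_geometric_realization)

  define g where "g t = \<pi> (spread y t)" for t
  \<comment> \<open>All vertices above the threshold index sets containing \<open>g t\<close>; both
    homotopies rest on this.\<close>
  have g_peak: "v \<in> P" "spread y t \<in> convex hull (U v)" "g t \<in> U v"
    if t: "\<rho> \<in> K" "t \<in> simplex_realization \<rho>" "threshold t < t v" for \<rho> t v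
  proof -
    have "v \<in> \<rho>"
      using t threshold_pos[OF t(2) finK[OF t(1)]] by (force simp: simplex_realization_def)
    then show "v \<in> P" using t(1) by (auto simp: K_def)
    show *: "spread y t \<in> convex hull (U v)"
    proof (rule spread_in_convex_hull[OF t(2) finK[OF t(1)] t(3)])
      fix \<sigma> assume \<sigma>: "\<sigma> \<subseteq> \<rho>" "v \<in> \<sigma>"
      then have "\<sigma> \<in> K"
        using K t(1) unfolding abstract_simplicial_complex_def by blast
      then show "y \<sigma> \<in> U v" using y \<sigma>(2) by blast
    qed
    show "g t \<in> U v" unfolding g_def by (rule hull(2)[OF \<open>v \<in> P\<close> *])
  qed
  have g_S: "g t \<in> S" and spread_T: "spread y t \<in> T"
    if t: "\<rho> \<in> K" "t \<in> simplex_realization \<rho>" for \<rho> t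
  proof -
    obtain v where v: "threshold t < t v" using threshold_exceeded[OF t(2) finK[OF t(1)]] .
    show "g t \<in> S" "spread y t \<in> T"
      using g_peak[OF t v] hull(1) unfolding S_def by blast+
  qed
  have g_cont: "continuous_on (simplex_realization \<rho>) g" if "\<rho> \<in> K" for \<rho>
    unfolding g_def
    by (rule continuous_on_compose2[OF \<pi>(1) continuous_on_spread[OF finK[OF that]]])
      (use spread_T[OF that] in auto)
  have cont_g: "continuous_map ?R (top_of_set S) g"
    using g_cont g_S by (intro continuous_map_from_geometric_realization) auto

  have "homotopic_with (\<lambda>_. True) (top_of_set S) (top_of_set S) (g \<circ> f) id"
  proof -
    have gf: "continuous_on S (g \<circ> f)"
      using continuous_map_compose[OF cont_f cont_g] by auto
    define H where "H w = (1 - fst w) *\<^sub>R (g \<circ> f) (snd w) + fst w *\<^sub>R snd w" for w :: "real \<times> 'a"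
    have H: "H w \<in> T \<and> \<pi> (H w) \<in> S" if w: "w \<in> {0..1} \<times> S" for w
    proof -
      obtain s z where sz: "w = (s, z)" "0 \<le> s" "s \<le> 1" "z \<in> S" using w by auto
      note t = f_supp[OF sz(4)] f(5)[OF sz(4)]
      \<comment> \<open>One vertex serves the whole segment: \<open>z\<close> is in
        \<open>U v\<close> because \<open>f z v\<close> is non-zero, and \<open>g (f z)\<close>
        because this coordinate exceeds the threshold.\<close>
      obtain v where v: "threshold (f z) < f z v" using threshold_exceeded[OF t(2) finK[OF t(1)]] .
      have "f z v \<noteq> 0" using v threshold_pos[OF t(2) finK[OF t(1)]] by simp
      then have "v \<in> P" "z \<in> U v" using fU[OF sz(4)] by auto
      moreover have "g (f z) \<in> U v" using g_peak(3)[OF t v] .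
      ultimately have "H w \<in> convex hull (U v)"
        using convexD_alt[OF convex_convex_hull, of "g (f z)" "U v" z s] sz(2,3)
        by (simp add: H_def sz(1) hull_inc)
      with \<open>v \<in> P\<close> show ?thesis using hull unfolding S_def by blast
    qed
    have "continuous_on ({0..1} \<times> S) H"
      unfolding H_def by (intro continuous_intros continuous_on_compose2[OF gf]) auto
    then have "continuous_on ({0..1} \<times> S) (\<lambda>w. \<pi> (H w))"
      by (rule continuous_on_compose2[OF \<pi>(1)]) (use H in auto)
    then have "continuous_map (prod_topology (top_of_set {0..1}) (top_of_set S)) (top_of_set S) (\<lambda>w. \<pi> (H w))"
      using H by auto
    moreover have "\<pi> (H (0, z)) = (g \<circ> f) z" "\<pi> (H (1, z)) = id z" if "z \<in> S" for z
    proof -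
      have "(g \<circ> f) z \<in> S" using g_S[OF f_supp f(5)] that by simp
      then show "\<pi> (H (0, z)) = (g \<circ> f) z" "\<pi> (H (1, z)) = id z"
        using \<pi>(2) SX that by (auto simp: H_def)
    qed
    ultimately show ?thesis
      by (subst homotopic_with) (auto intro!: exI[of _ "\<lambda>w. \<pi> (H w)"])
  qed
  moreover have "homotopic_with (\<lambda>_. True) ?R ?R (f \<circ> g) id"
  proof -
    have vertex: "v \<in> \<rho>" if "t \<in> simplex_realization \<rho>" "t v \<noteq> 0" for t :: "'v \<Rightarrow> real" and \<rho> v
      using that by (auto simp: simplex_realization_def)
    have lf_id: "locally_finite_support (simplex_realization \<rho>) id" if "\<rho> \<in> K" for \<rho>
      using vertex by (intro locally_finite_support_finite[OF finK[OF that]]) auto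
    have lf_peak: "locally_finite_support (simplex_realization \<rho>) peak" if "\<rho> \<in> K" for \<rho>
      using vertex[OF peak_in_simplex[OF _ finK[OF that]]]
      by (intro locally_finite_support_finite[OF finK[OF that]])
    \<comment> \<open>A vertex of \<open>t\<close> below the threshold need not index a set
      containing \<open>g t\<close>, so \<open>t\<close> and \<open>f (g t)\<close> need not share a
      simplex. Passing through \<open>peak\<close> splits the homotopy into two linear ones.\<close>
    have "homotopic_with (\<lambda>_. True) ?R ?R id peak"
    proof (rule homotopic_linear_geometric_realization[OF K])
      show "\<exists>\<rho>\<in>K. id t \<in> simplex_realization \<rho> \<and> peak t \<in> simplex_realization \<rho>"
        if "t \<in> topspace ?R" for t
        using that peak_in_simplex finK by (auto simp: topspace_geometric_realization)
    qed (use lf_id lf_peak continuous_on_peak finK in auto)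
    moreover have "homotopic_with (\<lambda>_. True) ?R ?R peak (f \<circ> g)"
    proof (rule homotopic_linear_geometric_realization[OF K])
      fix \<sigma> assume \<sigma>: "\<sigma> \<in> K"
      have gS: "g ` simplex_realization \<sigma> \<subseteq> S" using g_S[OF \<sigma>] by auto
      show "continuous_on (simplex_realization \<sigma>) (f \<circ> g)"
        using g_cont[OF \<sigma>] continuous_on_subset[OF f(1) gS] by (rule continuous_on_compose)
      show "locally_finite_support (simplex_realization \<sigma>) (f \<circ> g)"
        using locally_finite_support_compose[OF f(2) g_cont[OF \<sigma>] gS] by (simp add: comp_def)
      show "continuous_on (simplex_realization \<sigma>) peak" by (rule continuous_on_peak[OF finK[OF \<sigma>]])
      show "locally_finite_support (simplex_realization \<sigma>) peak" by (rule lf_peak[OF \<sigma>])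
    next
      fix t assume "t \<in> topspace ?R"
      then obtain \<sigma> where t: "\<sigma> \<in> K" "t \<in> simplex_realization \<sigma>"
        by (auto simp: topspace_geometric_realization)
      have gt: "g t \<in> S" by (rule g_S[OF t])
      let ?A = "{v. peak t v \<noteq> 0}" and ?B = "{v. f (g t) v \<noteq> 0}"
      note p = peak_in_simplex[OF t(2) finK[OF t(1)]]
      note A = simplex_realization_support[OF p finK[OF t(1)]]
      have fin: "finite (?A \<union> ?B)"
        using A(1) finK[OF t(1)] f(4)[OF gt] by (auto intro: finite_subset)
      \<comment> \<open>The point \<open>g t\<close> itself witnesses that the two supports together
        span a simplex.\<close>
      have "v \<in> P \<and> g t \<in> U v" if "v \<in> ?A \<union> ?B" for v
        using that g_peak[OF t peak_nonzero] fU[OF gt] by blast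
      then have "?A \<union> ?B \<in> K"
        unfolding K_def using fin A(2) by blast
      moreover have "peak t \<in> simplex_realization (?A \<union> ?B)"
        using A(3) simplex_realization_mono[OF fin, of ?A] by blast
      moreover have "f (g t) \<in> simplex_realization (?A \<union> ?B)"
        using f(5)[OF gt] simplex_realization_mono[OF fin, of ?B] by blast
      ultimately show "\<exists>\<rho>\<in>K. peak t \<in> simplex_realization \<rho> \<and> (f \<circ> g) t \<in> simplex_realization \<rho>"
        by auto
    qed
    ultimately show ?thesis
      by (meson homotopic_with_trans homotopic_with_symD)
  qed
  ultimately show ?thesis
    unfolding homotopy_equivalent_space_def S_def[symmetric] using cont_f cont_g by blast
qed

section \<open>The nerve theorem applied to restricted balls\<close>

text \<open>The radius \<open>\<tau>\<close> of the tangent balls is chosen separately for each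
  centre, which treats finite and infinite reach alike; the projection and its domain are the same
  for all centres.\<close>

lemma restricted_ball_union_homotopy_equivalence:
  fixes X P :: "'a::euclidean_space set"
  assumes X: "closed X" "0 < reach X"
    and r: "\<And>x. x \<in> P \<Longrightarrow> 0 < r x"
      "\<And>x \<tau>. x \<in> P \<Longrightarrow> reach X = ereal \<tau> \<Longrightarrow> r x \<le> sqrt (\<tau>\<^sup>2 + (\<tau> - infdist x X)\<^sup>2)"
  shows "top_of_set (\<Union>x\<in>P. restricted_ball X x (r x)) homotopy_equivalent_space
    geometric_realization (cech_complex X P r)"
proof -
  have \<tau>: "\<exists>\<tau>>0. ereal \<tau> \<le> reach X \<and> r x \<le> sqrt (\<tau>\<^sup>2 + (\<tau> - infdist x X)\<^sup>2)" if x: "x \<in> P" for x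
  proof (cases "reach X")
    case (real \<tau>)
    then show ?thesis using X(2) r(2)[OF x] by (intro exI[of _ \<tau>]) auto
  next
    case PInf
    \<comment> \<open>With infinite reach any positive \<open>\<tau>\<close> is admissible, and
      \<open>\<tau> = r x\<close> satisfies the radius bound trivially.\<close>
    have "r x \<le> sqrt ((r x)\<^sup>2 + (r x - infdist x X)\<^sup>2)"
      by (rule real_le_rsqrt) simp
    then show ?thesis using PInf r(1)[OF x] by (intro exI[of _ "r x"]) auto
  next
    case MInf
    then show ?thesis using X(2) by simp
  qed
  have "top_of_set (\<Union>x\<in>P. restricted_ball X x (r x)) homotopy_equivalent_space
    geometric_realization {\<sigma>. finite \<sigma> \<and> \<sigma> \<noteq> {} \<and> \<sigma> \<subseteq> P \<and> (\<Inter>x\<in>\<sigma>. restricted_ball X x (r x)) \<noteq> {}}"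
  proof (rule nerve_homotopy_equivalence)
    show "continuous_on {z. ereal (infdist z X) < reach X} (closest_point X)"
      by (rule continuous_on_closest_point_reach[OF X(1)])
    show "restricted_ball X x (r x) = X \<inter> ball x (r x)" for x
      by (auto simp: restricted_ball_def dist_norm)
    fix x assume x: "x \<in> P"
    obtain \<tau> where t: "0 < \<tau>" "ereal \<tau> \<le> reach X" "r x \<le> sqrt (\<tau>\<^sup>2 + (\<tau> - infdist x X)\<^sup>2)"
      using \<tau>[OF x] by blast
    show "convex hull (restricted_ball X x (r x)) \<subseteq> {z. ereal (infdist z X) < reach X}"
    proof
      fix z assume "z \<in> convex hull (restricted_ball X x (r x))"
      then have "infdist z X < \<tau>"
        using convex_hull_restricted_ball_infdist[OF X(1) t(1,2) r(1)[OF x] t(3)] by blast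
      then have "ereal (infdist z X) < ereal \<tau>" by simp
      also note t(2)
      finally show "z \<in> {z. ereal (infdist z X) < reach X}" by simp
    qed
    show "closest_point X z \<in> restricted_ball X x (r x)"
      if "z \<in> convex hull (restricted_ball X x (r x))" for z
      using closest_point_convex_hull_restricted_ball[OF X(1) t(1,2) r(1)[OF x] t(3) that] .
  qed (auto simp: closest_point_self)
  then show ?thesis by (simp add: cech_complex_def)
qed

theorem corollary10:
  fixes X :: "(real ^ 'd) set" and P :: "(real ^ 'd) set" and r :: "real ^ 'd \<Rightarrow> real"
  assumes "closed X"
    and "0 < reach X"
    and "\<And>x. x \<in> P \<Longrightarrow> 0 < r x"
    and "\<And>x. x \<in> P \<Longrightarrow> restricted_ball X x (r x) \<noteq> {}"
    and "\<And>x \<tau>. x \<in> P \<Longrightarrow> reach X = ereal \<tau> \<Longrightarrow> r x \<le> sqrt (\<tau>\<^sup>2 + (\<tau> - infdist x X)\<^sup>2)"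
  shows "top_of_set (\<Union>x\<in>P. restricted_ball X x (r x)) homotopy_equivalent_space
           geometric_realization (cech_complex X P r) \<and>
         (X \<subseteq> (\<Union>x\<in>P. restricted_ball X x (r x)) \<longrightarrow>
           top_of_set X homotopy_equivalent_space geometric_realization (cech_complex X P r))"
proof -
  have "(\<Union>x\<in>P. restricted_ball X x (r x)) = X" if "X \<subseteq> (\<Union>x\<in>P. restricted_ball X x (r x))"
    using that by (auto simp: restricted_ball_def)
  then show ?thesis
    using restricted_ball_union_homotopy_equivalence[of X P r, OF assms(1-3,5)] by auto
qed

end
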